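(* Let $p\ge 2$ be an integer, let $\zeta\in\mathbb C$ be a primitive $p$-th root of unity, and let $\mathfrak u,\mathfrak v\in M_p(\mathbb C)$ be the Weyl unitary matrices. Then the Weyl pair $(\mathfrak u,\mathfrak v)$ is a matrix extreme point of its matrix range $W(\mathfrak u,\mathfrak v)$.
   Context: $M_n(\mathbb C)$ is the algebra of complex $n\times n$ matrices with identity $1_n$. The Weyl unitary matrices (with respect to $p$ and $\zeta$) are $\mathfrak u=\mathrm{diag}(1,\zeta,\zeta^2,\dots,\zeta^{p-1})$ and the cyclic shift $\mathfrak v$, whose $(1,p)$-entry and $(k,k-1)$-entries ($2\le k\le p$) are $1$ and whose other entries are $0$. For a $g$-tuple $z=(z_1,\dots,z_g)$ of complex $d\times d$ matrices, $\mathcal O_z=\mathrm{Span}_{\mathbb C}\{1_d,z_k,z_k^*\mid k=1,\dots,g\}$, and the matrix range of $z$ is the sequence $W(z)=(W^n(z))_{n\in\mathbb N}$, where $W^n(z)\subseteq M_n(\mathbb C)^g$ is the set of all tuples $(\psi(z_1),\dots,\psi(z_g))$ with $\psi:\mathcal O_z\to M_n(\mathbb C)$ a unital completely positive linear map. For a $g$-tuple $a=(a_1,\dots,a_g)$ of $d\times d$ matrices and a linear map $\gamma:\mathbb C^n\to\mathbb C^d$, write $\gamma^*a\gamma=(\gamma^*a_1\gamma,\dots,\gamma^*a_g\gamma)$. For $g$-tuples $a,b$ of matrices of the same size, $a\simeq_{\rm u}b$ means $b=\gamma^*a\gamma$ for some unitary $\gamma$. A sequence $K=(K_n)_{n\in\mathbb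 N}$ with $K_n\subseteq M_n(\mathbb C)^g$ is matrix convex if $\sum_{j=1}^m\gamma_j^*a_j\gamma_j\in K_n$ for all $m\in\mathbb N$, all $a_j\in K_{n_j}$ and all linear maps $\gamma_j:\mathbb C^n\to\mathbb C^{n_j}$ with $\sum_{j=1}^m\gamma_j^*\gamma_j=1_n$; such $\gamma_j$ are called matrix convex coefficients and such a sum is a matrix convex combination of the $a_j$. (Matrix ranges are matrix convex.) If $K=(K_n)_n$ is matrix convex, an element $b\in K_n$ is a matrix extreme point of $K$ if, whenever $b=\sum_{j=1}^m\gamma_j^*a_j\gamma_j$ is a matrix convex combination of elements $a_j\in K_{n_j}$ such that each matrix convex coefficient $\gamma_j:\mathbb C^n\to\mathbb C^{n_j}$ is surjective, then, for each $j$, $n_j=n$ and $a_j\simeq_{\rm u}b$. *)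

theory Defs
  imports
    "Jordan_Normal_Form.Schur_Decomposition"
    "Jordan_Normal_Form.VS_Connect"
begin

text \<open>
  Conventions.  All matrices are of type \<^typ>\<open>complex mat\<close>, with their sizes given by membership in
  \<^const>\<open>carrier_mat\<close>; row and column indices start at 0.  A \<open>g\<close>-tuple of matrices is a list of
  length \<open>g\<close>.  A linear map from the \<open>n\<close>-dimensional to the \<open>d\<close>-dimensional column space is its
  matrix in \<open>carrier_mat d n\<close>.  The natural numbers of the theory of matrix convexity start at 1,
  so sequences \<open>K n\<close> indexed by the matrix size are only ever inspected at \<open>n > 0\<close>.
\<close>

abbreviation cmat_space :: "nat \<Rightarrow> (complex, complex mat) module" where
  "cmat_space n \<equiv> module_mat TYPE(complex) n n"

definition mat_tuples :: "nat \<Rightarrow> nat \<Rightarrow> complex mat list set" where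
  "mat_tuples g n = {a. length a = g \<and> set a \<subseteq> carrier_mat n n}"


section \<open>Weyl unitary matrices\<close>

definition primitive_root_unity :: "nat \<Rightarrow> complex \<Rightarrow> bool" where
  "primitive_root_unity p \<zeta> \<longleftrightarrow> 0 < p \<and> \<zeta> ^ p = 1 \<and> (\<forall>k. 0 < k \<and> k < p \<longrightarrow> \<zeta> ^ k \<noteq> 1)"

definition weyl_u :: "nat \<Rightarrow> complex \<Rightarrow> complex mat" where
  "weyl_u p \<zeta> = mat p p (\<lambda>(i, j). if i = j then \<zeta> ^ i else 0)"

definition weyl_v :: "nat \<Rightarrow> complex mat" where
  "weyl_v p = mat p p (\<lambda>(i, j). if (i = 0 \<and> j = p - 1) \<or> i = Suc j then 1 else 0)"


section \<open>Unital completely positive maps and matrix ranges\<close>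

definition op_span :: "nat \<Rightarrow> complex mat list \<Rightarrow> complex mat set" where
  "op_span d z = LinearCombinations.module.span class_ring (cmat_space d)
     ({1\<^sub>m d} \<union> set z \<union> mat_adjoint ` set z)"

definition psd_mat :: "nat \<Rightarrow> complex mat \<Rightarrow> bool" where
  "psd_mat n A \<longleftrightarrow> A \<in> carrier_mat n n \<and> (\<forall>x\<in>carrier_vec n. 0 \<le> (A *\<^sub>v x) \<bullet>c x)"

text \<open>The order on \<^typ>\<open>complex\<close> makes \<^term>\<open>0 \<le> (c::complex)\<close> say that \<open>c\<close> is real and
  nonnegative, so \<^const>\<open>psd_mat\<close> includes being Hermitian.\<close>

text \<open>The identification of \<open>k \<times> k\<close> matrices over the \<open>d \<times> d\<close> matrices with \<open>kd \<times> kd\<close>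
  matrices: the family \<open>X\<close> gives the blocks.\<close>

definition block_mat :: "nat \<Rightarrow> nat \<Rightarrow> (nat \<Rightarrow> nat \<Rightarrow> complex mat) \<Rightarrow> complex mat" where
  "block_mat k d X =
     mat (k * d) (k * d) (\<lambda>(i, j). X (i div d) (j div d) $$ (i mod d, j mod d))"

definition completely_positive_on ::
    "nat \<Rightarrow> nat \<Rightarrow> complex mat set \<Rightarrow> (complex mat \<Rightarrow> complex mat) \<Rightarrow> bool" where
  "completely_positive_on d n S \<psi> \<longleftrightarrow>
     (\<forall>k>0. \<forall>X. (\<forall>i<k. \<forall>j<k. X i j \<in> S) \<and> psd_mat (k * d) (block_mat k d X) \<longrightarrow>
        psd_mat (k * n) (block_mat k n (\<lambda>i j. \<psi> (X i j))))"

text \<open>Only the values of \<open>\<psi>\<close> on the subspace \<open>S\<close> of the \<open>d \<times> d\<close> matrices matter below;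
  \<^const>\<open>LinearCombinations.module_hom\<close> is the set of linear maps.\<close>

definition ucp_on ::
    "nat \<Rightarrow> nat \<Rightarrow> complex mat set \<Rightarrow> (complex mat \<Rightarrow> complex mat) \<Rightarrow> bool" where
  "ucp_on d n S \<psi> \<longleftrightarrow>
     \<psi> \<in> LinearCombinations.module_hom class_ring (cmat_space d\<lparr>carrier := S\<rparr>) (cmat_space n) \<and>
     \<psi> (1\<^sub>m d) = 1\<^sub>m n \<and>
     completely_positive_on d n S \<psi>"

definition matrix_range :: "nat \<Rightarrow> complex mat list \<Rightarrow> nat \<Rightarrow> complex mat list set" where
  "matrix_range d z n = {map \<psi> z | \<psi>. ucp_on d n (op_span d z) \<psi>}"


section \<open>Matrix convex sets and matrix extreme points\<close>

definition compress :: "complex mat \<Rightarrow> complex mat list \<Rightarrow> complex mat list" where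
  "compress \<gamma> a = map (\<lambda>x. mat_adjoint \<gamma> * x * \<gamma>) a"

definition unitary_mat :: "nat \<Rightarrow> complex mat \<Rightarrow> bool" where
  "unitary_mat n \<gamma> \<longleftrightarrow>
     \<gamma> \<in> carrier_mat n n \<and> mat_adjoint \<gamma> * \<gamma> = 1\<^sub>m n \<and> \<gamma> * mat_adjoint \<gamma> = 1\<^sub>m n"

definition unitarily_equiv :: "nat \<Rightarrow> complex mat list \<Rightarrow> complex mat list \<Rightarrow> bool" where
  "unitarily_equiv n a b \<longleftrightarrow> (\<exists>\<gamma>. unitary_mat n \<gamma> \<and> b = compress \<gamma> a)"

text \<open>A matrix convex combination has terms indexed by \<open>j < m\<close>; the \<open>j\<close>-th coefficient
  \<open>\<gamma> j\<close> maps into the space of dimension \<open>N j > 0\<close>.\<close>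

definition matrix_convex_coeffs ::
    "nat \<Rightarrow> nat \<Rightarrow> (nat \<Rightarrow> nat) \<Rightarrow> (nat \<Rightarrow> complex mat) \<Rightarrow> bool" where
  "matrix_convex_coeffs n m N \<gamma> \<longleftrightarrow>
     (\<forall>j<m. 0 < N j \<and> \<gamma> j \<in> carrier_mat (N j) n) \<and>
     finsum (cmat_space n) (\<lambda>j. mat_adjoint (\<gamma> j) * \<gamma> j) {..<m} = 1\<^sub>m n"

definition matrix_convex_comb ::
    "nat \<Rightarrow> nat \<Rightarrow> nat \<Rightarrow> (nat \<Rightarrow> complex mat) \<Rightarrow> (nat \<Rightarrow> complex mat list) \<Rightarrow> complex mat list" where
  "matrix_convex_comb g n m \<gamma> a =
     map (\<lambda>k. finsum (cmat_space n) (\<lambda>j. compress (\<gamma> j) (a j) ! k) {..<m}) [0..<g]"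

definition matrix_convex :: "nat \<Rightarrow> (nat \<Rightarrow> complex mat list set) \<Rightarrow> bool" where
  "matrix_convex g K \<longleftrightarrow>
     (\<forall>n>0. K n \<subseteq> mat_tuples g n) \<and>
     (\<forall>n>0. \<forall>m>0. \<forall>N \<gamma> a. matrix_convex_coeffs n m N \<gamma> \<and> (\<forall>j<m. a j \<in> K (N j)) \<longrightarrow>
        matrix_convex_comb g n m \<gamma> a \<in> K n)"

definition surjective_mat :: "nat \<Rightarrow> nat \<Rightarrow> complex mat \<Rightarrow> bool" where
  "surjective_mat d n \<gamma> \<longleftrightarrow> (\<lambda>x. \<gamma> *\<^sub>v x) ` carrier_vec n = carrier_vec d"

text \<open>Matrix extreme points are points of matrix convex sets; the definition carries the convexity
  of \<open>K\<close> along.\<close>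

definition matrix_extreme_point ::
    "nat \<Rightarrow> (nat \<Rightarrow> complex mat list set) \<Rightarrow> nat \<Rightarrow> complex mat list \<Rightarrow> bool" where
  "matrix_extreme_point g K n b \<longleftrightarrow>
     matrix_convex g K \<and> 0 < n \<and> b \<in> K n \<and>
     (\<forall>m>0. \<forall>N \<gamma> a.
        matrix_convex_coeffs n m N \<gamma> \<and> (\<forall>j<m. a j \<in> K (N j)) \<and>
        (\<forall>j<m. surjective_mat (N j) n (\<gamma> j)) \<and>
        b = matrix_convex_comb g n m \<gamma> a \<longrightarrow>
        (\<forall>j<m. N j = n \<and> unitarily_equiv n (a j) b))"


section \<open>Basic facts\<close>

lemma cmat_space_simps:
  "carrier (cmat_space n) = carrier_mat n n"
  "add (cmat_space n) = (+)"
  "zero (cmat_space n) = 0\<^sub>m n n"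
  "Module.module.smult (cmat_space n) = (\<cdot>\<^sub>m)"
  by (simp_all add: module_mat_def)

lemma module_cmat_space: "Module.module class_ring (cmat_space n)"
proof -
  have "abelian_group (cmat_space n)"
  proof (rule abelian_groupI)
    fix x assume "x \<in> carrier (cmat_space n)"
    then show "\<exists>y\<in>carrier (cmat_space n). y \<oplus>\<^bsub>cmat_space n\<^esub> x = \<zero>\<^bsub>cmat_space n\<^esub>"
      by (intro bexI[of _ "- x"]) (auto simp: cmat_space_simps)
  qed (auto simp: cmat_space_simps comm_add_mat)
  moreover have "cring (class_ring :: complex ring)"
    using class_field field.is_ring field_def domain_def by blast
  ultimately show ?thesis
    by (intro Module.module.intro module_axioms.intro)
      (auto simp: cmat_space_simps class_ring_simps add_smult_distrib_right_mat
        add_smult_distrib_left_mat mult_smult_assoc_mat intro!: eq_matI simp: algebra_simps)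
qed

lemma index_finsum_cmat_space:
  assumes "finite I" "\<And>j. j \<in> I \<Longrightarrow> f j \<in> carrier_mat n n" "r < n" "c < n"
  shows "finsum (cmat_space n) f I $$ (r, c) = (\<Sum>j\<in>I. f j $$ (r, c))"
proof -
  interpret M: Module.module class_ring "cmat_space n" by (rule module_cmat_space)
  show ?thesis using assms(1,2)
  proof (induction I rule: finite_induct)
    case empty
    show ?case using assms(3,4) by (simp add: cmat_space_simps)
  next
    case (insert j F)
    have fin: "finsum (cmat_space n) f F \<in> carrier_mat n n"
      using M.finsum_closed[of f F] insert.prems by (auto simp: cmat_space_simps)
    have "finsum (cmat_space n) f (insert j F) = f j + finsum (cmat_space n) f F"
      using M.finsum_insert[of F j f] insert by (auto simp: cmat_space_simps)
    then show ?case using insert fin assms(3,4) by auto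
  qed
qed

end

theory Submission
  imports Defs
begin

text \<open>
  Let \<open>\<psi>\<close> be unital completely positive and \<open>w\<close> unitary.  Two-positivity applied to the positive block
  matrix with rows \<open>(1, w)\<close> and \<open>(w\<^sup>*, 1)\<close> shows that \<open>\<psi>(w)\<close> is a contraction and
  \<open>\<psi>(w\<^sup>*) = \<psi>(w)\<^sup>*\<close>.  If \<open>w = \<Sum>\<^sub>j \<gamma>\<^sub>j\<^sup>* A\<^sub>j \<gamma>\<^sub>j\<close> with contractions \<open>A\<^sub>j\<close>, then
  \<open>\<Sum>\<^sub>j \<parallel>A\<^sub>j \<gamma>\<^sub>j x - \<gamma>\<^sub>j w x\<parallel>\<^sup>2 \<le> 0\<close>, so \<open>A\<^sub>j \<gamma>\<^sub>j = \<gamma>\<^sub>j w\<close>; the same for \<open>w\<^sup>*\<close> gives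
  \<open>A\<^sub>j\<^sup>* \<gamma>\<^sub>j = \<gamma>\<^sub>j w\<^sup>*\<close>, and hence \<open>\<gamma>\<^sub>j\<^sup>* \<gamma>\<^sub>j\<close> commutes with \<open>w\<close>.  For an irreducible tuple of
  unitaries \<open>\<gamma>\<^sub>j\<^sup>* \<gamma>\<^sub>j\<close> is therefore a scalar, so a surjective \<open>\<gamma>\<^sub>j\<close> is a positive multiple of a
  unitary, which implements the equivalence.  The Weyl pair is irreducible: a matrix commuting
  with \<open>\<uu>\<close> is diagonal, and commuting with \<open>\<vv>\<close> makes the diagonal constant.
\<close>

section \<open>Adjoint matrices and the complex inner product\<close>

lemma dim_mat_adjoint [simp]: "dim_row (mat_adjoint A) = dim_col A" "dim_col (mat_adjoint A) = dim_row A"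
  by (simp_all add: mat_adjoint_def)

lemma mat_adjoint_carrier [simp]: "mat_adjoint A \<in> carrier_mat n m \<longleftrightarrow> A \<in> carrier_mat m n"
  unfolding carrier_mat_def mem_Collect_eq dim_mat_adjoint by blast

lemma index_mat_adjoint [simp]:
  "i < dim_col A \<Longrightarrow> j < dim_row A \<Longrightarrow> mat_adjoint A $$ (i, j) = conjugate (A $$ (j, i))"
  unfolding mat_adjoint_def mat_of_rows_def by simp

lemma mat_adjoint_mat_adjoint [simp]: "mat_adjoint (mat_adjoint A) = A"
  by (rule eq_matI) simp_all

lemma mat_adjoint_mult:
  fixes A B :: "'a :: conjugatable_field mat"
  assumes "A \<in> carrier_mat n m" "B \<in> carrier_mat m k"
  shows "mat_adjoint (A * B) = mat_adjoint B * mat_adjoint A"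
  using assms
  by (intro eq_matI)
    (auto simp: scalar_prod_def sum_conjugate conjugate_dist_mul mult.commute intro!: sum.cong)

lemma mat_adjoint_smult:
  "mat_adjoint (c \<cdot>\<^sub>m A) = conjugate c \<cdot>\<^sub>m mat_adjoint A"
  by (rule eq_matI) (auto simp: conjugate_dist_mul)

text \<open>Expanding sesquilinear forms into double sums over entries turns the identities for
  adjoints, finite sums and blocks into exchanges of finite sums of complex numbers.\<close>

lemma cscalar_mult_mat_vec:
  fixes A :: "complex mat"
  assumes "A \<in> carrier_mat m n" "x \<in> carrier_vec n" "y \<in> carrier_vec m"
  shows "(A *\<^sub>v x) \<bullet>c y = (\<Sum>i<m. \<Sum>j<n. A $$ (i, j) * x $ j * cnj (y $ i))"
  using assms by (auto simp: scalar_prod_def sum_distrib_right lessThan_atLeast0 intro!: sum.cong)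

lemma cscalar_adjoint:
  fixes A :: "complex mat"
  assumes A: "A \<in> carrier_mat m n" and x: "x \<in> carrier_vec n" and y: "y \<in> carrier_vec m"
  shows "(A *\<^sub>v x) \<bullet>c y = x \<bullet>c (mat_adjoint A *\<^sub>v y)"
proof -
  have "x \<bullet>c (mat_adjoint A *\<^sub>v y) = (\<Sum>j<n. \<Sum>i<m. A $$ (i, j) * x $ j * cnj (y $ i))"
    using assms
    by (auto simp: scalar_prod_def sum_distrib_left lessThan_atLeast0 mult_ac intro!: sum.cong)
  then show ?thesis
    unfolding cscalar_mult_mat_vec[OF assms] by (simp add: sum.swap[of _ "{..<n}"])
qed

lemma cscalar_commute:
  fixes x y :: "complex vec"
  assumes "x \<in> carrier_vec n" "y \<in> carrier_vec n"
  shows "x \<bullet>c y = cnj (y \<bullet>c x)"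
  using assms by (auto simp: scalar_prod_def mult.commute intro!: sum.cong)

lemma cscalar_finsum:
  assumes I: "finite I" and f: "\<And>j. j \<in> I \<Longrightarrow> f j \<in> carrier_mat n n"
    and x: "x \<in> carrier_vec n" and y: "y \<in> carrier_vec n"
  shows "(finsum (cmat_space n) f I *\<^sub>v x) \<bullet>c y = (\<Sum>j\<in>I. (f j *\<^sub>v x) \<bullet>c y)"
proof -
  interpret M: Module.module class_ring "cmat_space n" by (rule module_cmat_space)
  have c: "finsum (cmat_space n) f I \<in> carrier_mat n n"
    using M.finsum_closed[of f I] f by (auto simp: cmat_space_simps)
  have "(finsum (cmat_space n) f I *\<^sub>v x) \<bullet>c y
      = (\<Sum>r<n. \<Sum>s<n. \<Sum>j\<in>I. f j $$ (r, s) * x $ s * cnj (y $ r))"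
    using x y by (simp add: cscalar_mult_mat_vec[OF c] index_finsum_cmat_space I f sum_distrib_right)
  also have "\<dots> = (\<Sum>r<n. \<Sum>j\<in>I. \<Sum>s<n. f j $$ (r, s) * x $ s * cnj (y $ r))"
    by (intro sum.cong refl sum.swap)
  also have "\<dots> = (\<Sum>j\<in>I. \<Sum>r<n. \<Sum>s<n. f j $$ (r, s) * x $ s * cnj (y $ r))"
    by (rule sum.swap)
  also have "\<dots> = (\<Sum>j\<in>I. (f j *\<^sub>v x) \<bullet>c y)"
    by (intro sum.cong refl) (simp add: cscalar_mult_mat_vec[OF f x y])
  finally show ?thesis .
qed

section \<open>Positivity of block matrices\<close>

lemma sum_div_mod:
  fixes f :: "nat \<Rightarrow> nat \<Rightarrow> 'a :: comm_monoid_add"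
  shows "(\<Sum>r<k * n. f (r div n) (r mod n)) = (\<Sum>i<k. \<Sum>s<n. f i s)"
proof -
  have "(\<Sum>r<k * n. f (r div n) (r mod n)) = (\<Sum>i<k. \<Sum>r=i * n..<i * n + n. f (r div n) (r mod n))"
    by (rule sum.nat_group[symmetric])
  also have "\<dots> = (\<Sum>i<k. \<Sum>s<n. f i s)"
  proof (rule sum.cong[OF refl])
    fix i
    have d: "r div n = i" if "i * n \<le> r" "r < i * n + n" for r
      using that by (intro div_nat_eqI) (auto simp: algebra_simps)
    show "(\<Sum>r=i * n..<i * n + n. f (r div n) (r mod n)) = (\<Sum>s<n. f i s)"
      by (rule sum.reindex_bij_witness[of _ "\<lambda>s. i * n + s" "\<lambda>r. r - i * n"])
        (auto simp: d minus_div_mult_eq_mod[symmetric])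
  qed
  finally show ?thesis .
qed

text \<open>The vector \<open>X\<close> is the concatenation of the \<open>k\<close> vectors
  \<open>x i\<close>: an index \<open>r\<close> of the large matrix is the pair of the block index
  \<open>r div n\<close> and the inner index \<open>r mod n\<close>, and \<open>sum_div_mod\<close>
  splits each sum along this pairing.\<close>

lemma cscalar_block_mat:
  assumes "0 < n" and Y: "\<And>i l. i < k \<Longrightarrow> l < k \<Longrightarrow> Y i l \<in> carrier_mat n n"
    and x: "\<And>i. i < k \<Longrightarrow> x i \<in> carrier_vec n"
  defines "X \<equiv> vec (k * n) (\<lambda>r. x (r div n) $ (r mod n))"
  shows "(block_mat k n Y *\<^sub>v X) \<bullet>c X = (\<Sum>i<k. \<Sum>l<k. (Y i l *\<^sub>v x l) \<bullet>c x i)"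
proof -
  have B: "block_mat k n Y \<in> carrier_mat (k * n) (k * n)" "X \<in> carrier_vec (k * n)"
    by (auto simp: block_mat_def X_def)
  have "(block_mat k n Y *\<^sub>v X) \<bullet>c X = (\<Sum>r<k * n. \<Sum>c<k * n.
      Y (r div n) (c div n) $$ (r mod n, c mod n) * x (c div n) $ (c mod n) * cnj (x (r div n) $ (r mod n)))"
    unfolding cscalar_mult_mat_vec[OF B(1,2,2)] by (simp add: block_mat_def X_def)
  also have "\<dots> = (\<Sum>i<k. \<Sum>s<n. \<Sum>l<k. \<Sum>t<n. Y i l $$ (s, t) * x l $ t * cnj (x i $ s))"
    by (simp add: sum_div_mod[where f = "\<lambda>l t. Y _ l $$ (_, t) * x l $ t * cnj _"]
        sum_div_mod[where f = "\<lambda>i s. \<Sum>l<k. \<Sum>t<n. Y i l $$ (s, t) * x l $ t * cnj (x i $ s)"])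
  also have "\<dots> = (\<Sum>i<k. \<Sum>l<k. \<Sum>s<n. \<Sum>t<n. Y i l $$ (s, t) * x l $ t * cnj (x i $ s))"
    by (intro sum.cong refl sum.swap)
  also have "\<dots> = (\<Sum>i<k. \<Sum>l<k. (Y i l *\<^sub>v x l) \<bullet>c x i)"
    by (intro sum.cong refl) (simp add: cscalar_mult_mat_vec[OF Y x x])
  finally show ?thesis .
qed

text \<open>Every vector of length \<open>k * n\<close> is a concatenation of \<open>k\<close>
  vectors of length \<open>n\<close>, so positivity of a block matrix is a condition on families
  \<open>x\<close>. The later positivity arguments work in this form and stay free of block
  indices.\<close>

lemma psd_block_mat_iff:
  assumes n: "0 < n" and Y: "\<And>i l. i < k \<Longrightarrow> l < k \<Longrightarrow> Y i l \<in> carrier_mat n n"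
  shows "psd_mat (k * n) (block_mat k n Y) \<longleftrightarrow>
    (\<forall>x. (\<forall>i<k. x i \<in> carrier_vec n) \<longrightarrow> 0 \<le> (\<Sum>i<k. \<Sum>l<k. (Y i l *\<^sub>v x l) \<bullet>c x i))"
    (is "?L \<longleftrightarrow> ?R")
proof -
  have eq: "(block_mat k n Y *\<^sub>v X) \<bullet>c X = (\<Sum>i<k. \<Sum>l<k. (Y i l *\<^sub>v x l) \<bullet>c x i)"
    if "\<forall>i<k. x i \<in> carrier_vec n" "X = vec (k * n) (\<lambda>r. x (r div n) $ (r mod n))" for x X
    using cscalar_block_mat[OF n, of k Y x] Y that by blast
  show ?thesis
  proof
    assume L: ?L
    show ?R
    proof (intro allI impI)
      fix x :: "nat \<Rightarrow> complex vec" assume x: "\<forall>i<k. x i \<in> carrier_vec n"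
      define X where "X = vec (k * n) (\<lambda>r. x (r div n) $ (r mod n))"
      have "X \<in> carrier_vec (k * n)" by (simp add: X_def)
      then show "0 \<le> (\<Sum>i<k. \<Sum>l<k. (Y i l *\<^sub>v x l) \<bullet>c x i)"
        using L unfolding psd_mat_def eq[OF x X_def, symmetric] by blast
    qed
  next
    assume R: ?R
    show ?L unfolding psd_mat_def
    proof (intro conjI ballI)
      show "block_mat k n Y \<in> carrier_mat (k * n) (k * n)" by (simp add: block_mat_def)
      fix w :: "complex vec" assume w: "w \<in> carrier_vec (k * n)"
      \<comment> \<open>The \<open>i\<close>-th slice of \<open>w\<close>; reassembling the slices
        gives back \<open>w\<close>, because \<open>(r div n) * n + r mod n = r\<close>.\<close>
      define x where "x i = vec n (\<lambda>s. w $ (i * n + s))" for i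
      have w_eq: "w = vec (k * n) (\<lambda>r. x (r div n) $ (r mod n))"
        using w n by (intro eq_vecI) (simp_all add: x_def)
      have x: "\<forall>i<k. x i \<in> carrier_vec n" by (simp add: x_def)
      show "0 \<le> (block_mat k n Y *\<^sub>v w) \<bullet>c w"
        unfolding eq[OF x w_eq] using R x by blast
    qed
  qed
qed

section \<open>Unital completely positive maps and matrix convexity of matrix ranges\<close>

lemma op_span_props:
  assumes z: "set z \<subseteq> carrier_mat d d"
  shows op_span_carrier: "op_span d z \<subseteq> carrier_mat d d"
    and one_in_op_span: "1\<^sub>m d \<in> op_span d z"
    and in_op_span: "w \<in> set z \<Longrightarrow> w \<in> op_span d z"
    and adjoint_in_op_span: "w \<in> set z \<Longrightarrow> mat_adjoint w \<in> op_span d z"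
    and add_in_op_span: "A \<in> op_span d z \<Longrightarrow> B \<in> op_span d z \<Longrightarrow> A + B \<in> op_span d z"
    and smult_in_op_span: "A \<in> op_span d z \<Longrightarrow> c \<cdot>\<^sub>m A \<in> op_span d z"
proof -
  interpret M: Module.module class_ring "cmat_space d" by (rule module_cmat_space)
  let ?G = "{1\<^sub>m d} \<union> set z \<union> mat_adjoint ` set z"
  have G: "?G \<subseteq> carrier (cmat_space d)" using z by (auto simp: cmat_space_simps)
  interpret S: LinearCombinations.submodule class_ring "op_span d z" "cmat_space d"
    unfolding op_span_def by (rule M.span_is_submodule[OF G])
  have own: "?G \<subseteq> op_span d z" unfolding op_span_def by (rule M.in_own_span[OF G])
  show "op_span d z \<subseteq> carrier_mat d d" using S.subset by (simp add: cmat_space_simps)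
  show "1\<^sub>m d \<in> op_span d z" "w \<in> set z \<Longrightarrow> w \<in> op_span d z"
    "w \<in> set z \<Longrightarrow> mat_adjoint w \<in> op_span d z" using own by auto
  show "A \<in> op_span d z \<Longrightarrow> B \<in> op_span d z \<Longrightarrow> A + B \<in> op_span d z"
    using S.m_closed[of A B] by (simp add: cmat_space_simps)
  show "A \<in> op_span d z \<Longrightarrow> c \<cdot>\<^sub>m A \<in> op_span d z"
    using S.smult_closed[of c A] by (simp add: cmat_space_simps class_ring_simps)
qed

text \<open>Linearity is unwrapped from the module language into matrix identities, the form in
  which it is used below.\<close>

lemma ucp_on_iff:
  "ucp_on d n S \<psi> \<longleftrightarrow> (\<forall>A\<in>S. \<psi> A \<in> carrier_mat n n) \<and>
     (\<forall>A\<in>S. \<forall>B\<in>S. \<psi> (A + B) = \<psi> A + \<psi> B) \<and> (\<forall>c. \<forall>A\<in>S. \<psi> (c \<cdot>\<^sub>m A) = c \<cdot>\<^sub>m \<psi> A) \<and>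
     \<psi> (1\<^sub>m d) = 1\<^sub>m n \<and> completely_positive_on d n S \<psi>"
  unfolding ucp_on_def LinearCombinations.module_hom_def
  by (auto simp: cmat_space_simps class_ring_simps)

lemma ucp_on_carrier: "ucp_on d n S \<psi> \<Longrightarrow> A \<in> S \<Longrightarrow> \<psi> A \<in> carrier_mat n n"
  by (simp add: ucp_on_iff)

text \<open>The identity map on the operator span is unital and completely positive, and it fixes
  the generators.\<close>

lemma generators_in_matrix_range:
  assumes "set z \<subseteq> carrier_mat d d"
  shows "z \<in> matrix_range d z d"
  using op_span_carrier[OF assms] unfolding matrix_range_def ucp_on_iff
  by (intro CollectI exI[of _ "\<lambda>X. X"]) (auto simp: completely_positive_on_def)

lemma finsum_cmat_closed:
  assumes "\<And>j. j \<in> I \<Longrightarrow> f j \<in> carrier_mat n n"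
  shows "finsum (cmat_space n) f I \<in> carrier_mat n n"
proof -
  interpret M: Module.module class_ring "cmat_space n" by (rule module_cmat_space)
  show ?thesis using M.finsum_closed[of f I] assms by (auto simp: cmat_space_simps)
qed

text \<open>The quadratic form of the amplified sum at a family \<open>x\<close> is the sum over
  \<open>j\<close> of the forms of the amplified \<open>\<psi> j\<close> at the families
  \<open>\<gamma> j *\<^sub>v x i\<close>, so complete positivity passes to the sum. The identity
  for the coefficients makes the sum unital. This is what makes matrix ranges matrix convex.\<close>

lemma compress_ucp_on:
  assumes n: "0 < n"
    and S: "\<And>A B. A \<in> S \<Longrightarrow> B \<in> S \<Longrightarrow> A + B \<in> S" "\<And>c A. A \<in> S \<Longrightarrow> c \<cdot>\<^sub>m A \<in> S" "1\<^sub>m d \<in> S"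
    and co: "matrix_convex_coeffs n m N \<gamma>"
    and ucp: "\<And>j. j < m \<Longrightarrow> ucp_on d (N j) S (\<psi> j)"
  shows "ucp_on d n S (\<lambda>X. finsum (cmat_space n) (\<lambda>j. mat_adjoint (\<gamma> j) * \<psi> j X * \<gamma> j) {..<m})"
    (is "ucp_on d n S ?\<Psi>")
proof -
  interpret M: Module.module class_ring "cmat_space n" by (rule module_cmat_space)
  have N: "0 < N j" "\<gamma> j \<in> carrier_mat (N j) n" if "j < m" for j
    using co that by (auto simp: matrix_convex_coeffs_def)
  have \<psi>: "\<psi> j A \<in> carrier_mat (N j) (N j)" if "j < m" "A \<in> S" for j A
    using ucp_on_carrier[OF ucp] that by blast
  have summand: "mat_adjoint (\<gamma> j) * \<psi> j A * \<gamma> j \<in> carrier_mat n n" if "j < m" "A \<in> S" for j A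
    using N[OF that(1)] \<psi>[OF that] by (intro mult_carrier_mat) auto
  have closed: "?\<Psi> A \<in> carrier_mat n n" if "A \<in> S" for A
    using summand that by (intro finsum_cmat_closed) auto
  \<comment> \<open>Entrywise the module sum is an ordinary complex sum, so additivity and
    homogeneity reduce to the individual summands.\<close>
  have entry: "?\<Psi> A $$ (r, c) = (\<Sum>j<m. (mat_adjoint (\<gamma> j) * \<psi> j A * \<gamma> j) $$ (r, c))"
    if "A \<in> S" "r < n" "c < n" for A r c
    using summand that by (intro index_finsum_cmat_space) auto
  have dim: "dim_row (mat_adjoint (\<gamma> j) * \<psi> j A * \<gamma> j) = n" "dim_col (mat_adjoint (\<gamma> j) * \<psi> j A * \<gamma> j) = n"
    if "j < m" for j A
    using N[OF that] by auto
  have add: "?\<Psi> (A + B) = ?\<Psi> A + ?\<Psi> B" if A: "A \<in> S" and B: "B \<in> S" for A B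
  proof (rule eq_matI)
    have *: "mat_adjoint (\<gamma> j) * \<psi> j (A + B) * \<gamma> j =
        mat_adjoint (\<gamma> j) * \<psi> j A * \<gamma> j + mat_adjoint (\<gamma> j) * \<psi> j B * \<gamma> j" if j: "j < m" for j
    proof -
      have "\<psi> j (A + B) = \<psi> j A + \<psi> j B" using ucp[OF j] A B by (auto simp: ucp_on_iff)
      then show ?thesis using N[OF j] \<psi>[OF j A] \<psi>[OF j B]
        by (simp add: mult_add_distrib_mat[of _ n "N j"] add_mult_distrib_mat[of _ n "N j"])
    qed
    fix r c assume "r < dim_row (?\<Psi> A + ?\<Psi> B)" "c < dim_col (?\<Psi> A + ?\<Psi> B)"
    then have rc: "r < n" "c < n" using closed[OF B] by auto
    have "?\<Psi> (A + B) $$ (r, c) =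
        (\<Sum>j<m. (mat_adjoint (\<gamma> j) * \<psi> j A * \<gamma> j) $$ (r, c) + (mat_adjoint (\<gamma> j) * \<psi> j B * \<gamma> j) $$ (r, c))"
      unfolding entry[OF S(1)[OF A B] rc]
    proof (intro sum.cong refl)
      fix j assume "j \<in> {..<m}"
      then have j: "j < m" by simp
      show "(mat_adjoint (\<gamma> j) * \<psi> j (A + B) * \<gamma> j) $$ (r, c) =
          (mat_adjoint (\<gamma> j) * \<psi> j A * \<gamma> j) $$ (r, c) + (mat_adjoint (\<gamma> j) * \<psi> j B * \<gamma> j) $$ (r, c)"
        unfolding *[OF j] by (rule index_add_mat(1)) (simp_all only: dim[OF j] rc)
    qed
    also have "\<dots> = ?\<Psi> A $$ (r, c) + ?\<Psi> B $$ (r, c)"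
      unfolding entry[OF A rc] entry[OF B rc] by (rule sum.distrib)
    also have "\<dots> = (?\<Psi> A + ?\<Psi> B) $$ (r, c)"
      using closed[OF B] rc by (intro index_add_mat(1)[symmetric]) auto
    finally show "?\<Psi> (A + B) $$ (r, c) = (?\<Psi> A + ?\<Psi> B) $$ (r, c)" .
  qed (use closed[OF A] closed[OF B] closed[OF S(1)[OF A B]] in auto)
  have smult: "?\<Psi> (a \<cdot>\<^sub>m A) = a \<cdot>\<^sub>m ?\<Psi> A" if A: "A \<in> S" for a A
  proof (rule eq_matI)
    have *: "mat_adjoint (\<gamma> j) * \<psi> j (a \<cdot>\<^sub>m A) * \<gamma> j =
        a \<cdot>\<^sub>m (mat_adjoint (\<gamma> j) * \<psi> j A * \<gamma> j)" if j: "j < m" for j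
    proof -
      have "\<psi> j (a \<cdot>\<^sub>m A) = a \<cdot>\<^sub>m \<psi> j A" using ucp[OF j] A by (auto simp: ucp_on_iff)
      then show ?thesis using N[OF j] \<psi>[OF j A]
        by (simp add: mult_smult_distrib[of _ n "N j"] mult_smult_assoc_mat[of _ n "N j"])
    qed
    fix r c assume "r < dim_row (a \<cdot>\<^sub>m ?\<Psi> A)" "c < dim_col (a \<cdot>\<^sub>m ?\<Psi> A)"
    then have rc: "r < n" "c < n" using closed[OF A] by auto
    have "?\<Psi> (a \<cdot>\<^sub>m A) $$ (r, c) = (\<Sum>j<m. a * (mat_adjoint (\<gamma> j) * \<psi> j A * \<gamma> j) $$ (r, c))"
      unfolding entry[OF S(2)[OF A] rc]
    proof (intro sum.cong refl)
      fix j assume "j \<in> {..<m}"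
      then have j: "j < m" by simp
      show "(mat_adjoint (\<gamma> j) * \<psi> j (a \<cdot>\<^sub>m A) * \<gamma> j) $$ (r, c) =
          a * (mat_adjoint (\<gamma> j) * \<psi> j A * \<gamma> j) $$ (r, c)"
        unfolding *[OF j] by (rule index_smult_mat(1)) (simp_all only: dim[OF j] rc)
    qed
    also have "\<dots> = a * ?\<Psi> A $$ (r, c)"
      unfolding entry[OF A rc] by (rule sum_distrib_left[symmetric])
    also have "\<dots> = (a \<cdot>\<^sub>m ?\<Psi> A) $$ (r, c)"
      using closed[OF A] rc by (intro index_smult_mat(1)[symmetric]) auto
    finally show "?\<Psi> (a \<cdot>\<^sub>m A) $$ (r, c) = (a \<cdot>\<^sub>m ?\<Psi> A) $$ (r, c)" .
  qed (use closed[OF A] closed[OF S(2)[OF A]] in auto)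
  \<comment> \<open>Each \<open>\<psi> j\<close> is unital, so at the identity the sum collapses to
    the sum of the Gram matrices of the coefficients.\<close>
  have "?\<Psi> (1\<^sub>m d) = finsum (cmat_space n) (\<lambda>j. mat_adjoint (\<gamma> j) * \<gamma> j) {..<m}"
  proof (rule M.finsum_cong')
    fix j assume "j \<in> {..<m}"
    then have j: "j < m" by simp
    have "\<psi> j (1\<^sub>m d) = 1\<^sub>m (N j)" using ucp[OF j] by (auto simp: ucp_on_iff)
    then show "mat_adjoint (\<gamma> j) * \<psi> j (1\<^sub>m d) * \<gamma> j = mat_adjoint (\<gamma> j) * \<gamma> j"
      using N[OF j] by (simp add: right_mult_one_mat[of _ n "N j"])
  qed (use N in \<open>fastforce simp: cmat_space_simps\<close>)+
  then have one: "?\<Psi> (1\<^sub>m d) = 1\<^sub>m n" using co by (simp add: matrix_convex_coeffs_def)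
  have cp: "completely_positive_on d n S ?\<Psi>"
    unfolding completely_positive_on_def
  proof (intro allI impI, elim conjE)
    fix k :: nat and X
    assume k: "0 < k" and XS: "\<forall>i<k. \<forall>j<k. X i j \<in> S" and psd: "psd_mat (k * d) (block_mat k d X)"
    show "psd_mat (k * n) (block_mat k n (\<lambda>i j. ?\<Psi> (X i j)))"
    proof (subst psd_block_mat_iff[OF n], use XS closed in blast, intro allI impI)
      fix x :: "nat \<Rightarrow> complex vec" assume x: "\<forall>i<k. x i \<in> carrier_vec n"
      \<comment> \<open>Positivity of the amplified \<open>\<psi> j\<close> is tested on the family
        \<open>\<gamma> j *\<^sub>v x i\<close>; moving the outer \<open>\<gamma> j\<close> across
        the inner product later turns this into the form of the compressed summand.\<close>
      have "0 \<le> (\<Sum>i<k. \<Sum>l<k. (\<psi> j (X i l) *\<^sub>v (\<gamma> j *\<^sub>v x l)) \<bullet>c (\<gamma> j *\<^sub>v x i))" if j: "j < m" for j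
      proof -
        have "psd_mat (k * N j) (block_mat k (N j) (\<lambda>i l. \<psi> j (X i l)))"
          using ucp[OF j] k XS psd by (auto simp: ucp_on_iff completely_positive_on_def)
        moreover have "\<forall>i<k. \<gamma> j *\<^sub>v x i \<in> carrier_vec (N j)" using N[OF j] x by auto
        ultimately show ?thesis
          using psd_block_mat_iff[OF N(1)[OF j], of k "\<lambda>i l. \<psi> j (X i l)"] \<psi>[OF j] XS by simp
      qed
      then have "0 \<le> (\<Sum>j<m. \<Sum>i<k. \<Sum>l<k. (\<psi> j (X i l) *\<^sub>v (\<gamma> j *\<^sub>v x l)) \<bullet>c (\<gamma> j *\<^sub>v x i))"
        by (rule sum_nonneg) simp
      also have "\<dots> = (\<Sum>i<k. \<Sum>j<m. \<Sum>l<k. (\<psi> j (X i l) *\<^sub>v (\<gamma> j *\<^sub>v x l)) \<bullet>c (\<gamma> j *\<^sub>v x i))"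
        by (rule sum.swap)
      also have "\<dots> = (\<Sum>i<k. \<Sum>l<k. \<Sum>j<m. (\<psi> j (X i l) *\<^sub>v (\<gamma> j *\<^sub>v x l)) \<bullet>c (\<gamma> j *\<^sub>v x i))"
        by (intro sum.cong refl sum.swap)
      also have "\<dots> = (\<Sum>i<k. \<Sum>l<k. (?\<Psi> (X i l) *\<^sub>v x l) \<bullet>c x i)"
      proof (intro sum.cong refl)
        fix i l assume "i \<in> {..<k}" "l \<in> {..<k}"
        then have il: "i < k" "l < k" by auto
        have "(\<psi> j (X i l) *\<^sub>v (\<gamma> j *\<^sub>v x l)) \<bullet>c (\<gamma> j *\<^sub>v x i) =
            (mat_adjoint (\<gamma> j) * \<psi> j (X i l) * \<gamma> j *\<^sub>v x l) \<bullet>c x i" if j: "j < m" for j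
        proof -
          have c: "\<psi> j (X i l) \<in> carrier_mat (N j) (N j)" "x l \<in> carrier_vec n" "x i \<in> carrier_vec n"
            "mat_adjoint (\<gamma> j) \<in> carrier_mat n (N j)" "\<gamma> j \<in> carrier_mat (N j) n"
            using \<psi>[OF j] XS il x N[OF j] by auto
          have "(mat_adjoint (\<gamma> j) * \<psi> j (X i l) * \<gamma> j *\<^sub>v x l) \<bullet>c x i
              = (mat_adjoint (\<gamma> j) *\<^sub>v (\<psi> j (X i l) *\<^sub>v (\<gamma> j *\<^sub>v x l))) \<bullet>c x i"
            using c by (simp add: assoc_mult_mat_vec[of _ n "N j" _ n] assoc_mult_mat_vec[of _ n "N j" _ "N j"]
                del: assoc_mult_mat)
          also have "\<dots> = (\<psi> j (X i l) *\<^sub>v (\<gamma> j *\<^sub>v x l)) \<bullet>c (\<gamma> j *\<^sub>v x i)"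
            using c by (subst cscalar_adjoint[of _ n "N j"]) auto
          finally show ?thesis ..
        qed
        then show "(\<Sum>j<m. (\<psi> j (X i l) *\<^sub>v (\<gamma> j *\<^sub>v x l)) \<bullet>c (\<gamma> j *\<^sub>v x i)) = (?\<Psi> (X i l) *\<^sub>v x l) \<bullet>c x i"
          using summand XS il x by (subst cscalar_finsum) auto
      qed
      finally show "0 \<le> (\<Sum>i<k. \<Sum>l<k. (?\<Psi> (X i l) *\<^sub>v x l) \<bullet>c x i)" .
    qed
  qed
  show ?thesis unfolding ucp_on_iff using closed add smult one cp by blast
qed

text \<open>A unital completely positive map is chosen for each point \<open>a j\<close>; by
  \<open>compress_ucp_on\<close> the sum of their compressions is again such a map, and it sends
  \<open>z\<close> to the matrix convex combination.\<close>

lemma matrix_convex_matrix_range: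
  assumes z: "set z \<subseteq> carrier_mat d d"
  shows "matrix_convex (length z) (matrix_range d z)"
  unfolding matrix_convex_def
proof (intro conjI allI impI, goal_cases)
  case (1 n)
  then show ?case using in_op_span[OF z]
    by (auto simp: matrix_range_def mat_tuples_def ucp_on_iff)
next
  case (2 n m N \<gamma> a)
  interpret M: Module.module class_ring "cmat_space n" by (rule module_cmat_space)
  have co: "matrix_convex_coeffs n m N \<gamma>" using 2 by simp
  have "\<forall>j\<in>{..<m}. \<exists>\<psi>. a j = map \<psi> z \<and> ucp_on d (N j) (op_span d z) \<psi>"
    using 2 by (auto simp: matrix_range_def)
  then obtain \<psi> where \<psi>: "\<And>j. j < m \<Longrightarrow> a j = map (\<psi> j) z"
      "\<And>j. j < m \<Longrightarrow> ucp_on d (N j) (op_span d z) (\<psi> j)"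
    unfolding bchoice_iff by auto
  let ?\<Psi> = "\<lambda>X. finsum (cmat_space n) (\<lambda>j. mat_adjoint (\<gamma> j) * \<psi> j X * \<gamma> j) {..<m}"
  have "ucp_on d n (op_span d z) ?\<Psi>"
    using op_span_props[OF z] \<psi>(2) by (intro compress_ucp_on[OF \<open>0 < n\<close> _ _ _ co]) auto
  moreover have "matrix_convex_comb (length z) n m \<gamma> a = map ?\<Psi> z"
  proof (rule nth_equalityI)
    fix k assume "k < length (matrix_convex_comb (length z) n m \<gamma> a)"
    then have k: "k < length z" by (simp add: matrix_convex_comb_def)
    have "finsum (cmat_space n) (\<lambda>j. compress (\<gamma> j) (a j) ! k) {..<m} = ?\<Psi> (z ! k)"
    proof (rule M.finsum_cong')
      have "\<psi> j (z ! k) \<in> carrier_mat (N j) (N j) \<and> \<gamma> j \<in> carrier_mat (N j) n" if "j < m" for j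
        using ucp_on_carrier[OF \<psi>(2)[OF that] in_op_span[OF z]] k co that by (simp add: matrix_convex_coeffs_def)
      then show "(\<lambda>j. mat_adjoint (\<gamma> j) * \<psi> j (z ! k) * \<gamma> j) \<in> {..<m} \<rightarrow> carrier (cmat_space n)"
        by (fastforce simp: cmat_space_simps)
    qed (use k \<psi>(1) in \<open>auto simp: compress_def\<close>)
    then show "matrix_convex_comb (length z) n m \<gamma> a ! k = map ?\<Psi> z ! k"
      using k by (simp add: matrix_convex_comb_def)
  qed (simp add: matrix_convex_comb_def)
  ultimately show ?case unfolding matrix_range_def by blast
qed


section \<open>Images of unitaries under unital completely positive maps\<close>

lemma mat_eq_cscalarI:
  fixes A B :: "complex mat"
  assumes A: "A \<in> carrier_mat m n" and B: "B \<in> carrier_mat m n"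
    and eq: "\<And>x y. x \<in> carrier_vec n \<Longrightarrow> y \<in> carrier_vec m \<Longrightarrow> (A *\<^sub>v x) \<bullet>c y = (B *\<^sub>v x) \<bullet>c y"
  shows "A = B"
proof (rule eq_matI)
  fix i j assume "i < dim_row B" "j < dim_col B"
  then have ij: "i < m" "j < n" using B by auto
  have "(C *\<^sub>v unit_vec n j) \<bullet>c unit_vec m i = C $$ (i, j)" if C: "C \<in> carrier_mat m n" for C :: "complex mat"
  proof -
    have "(C *\<^sub>v unit_vec n j) \<bullet>c unit_vec m i = (\<Sum>r<m. if r = i then (\<Sum>s<n. if s = j then C $$ (i, j) else 0) else 0)"
      unfolding cscalar_mult_mat_vec[OF C unit_vec_carrier unit_vec_carrier]
      using ij by (intro sum.cong refl) (auto simp: unit_vec_def if_distrib[of "(*) a" for a] cong: if_cong)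
    then show ?thesis using ij by simp
  qed
  then show "A $$ (i, j) = B $$ (i, j)"
    using eq[of "unit_vec n j" "unit_vec m i"] A B by simp
qed (use A B in auto)

lemma cscalar_smult_left:
  fixes x y :: "complex vec"
  shows "x \<in> carrier_vec n \<Longrightarrow> y \<in> carrier_vec n \<Longrightarrow> (c \<cdot>\<^sub>v x) \<bullet>c y = c * (x \<bullet>c y)"
  by simp

lemma cscalar_smult_right:
  fixes x y :: "complex vec"
  shows "x \<in> carrier_vec n \<Longrightarrow> y \<in> carrier_vec n \<Longrightarrow> x \<bullet>c (c \<cdot>\<^sub>v y) = cnj c * (x \<bullet>c y)"
  by (simp add: conjugate_smult_vec)

lemma Im_cscalar_self [simp]: "Im (x \<bullet>c x) = 0" for x :: "complex vec"
  using conjugate_square_ge_0_vec[of x] by (simp add: less_eq_complex_def)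

lemma unitary_mat_adjoint: "unitary_mat n w \<Longrightarrow> unitary_mat n (mat_adjoint w)"
  by (auto simp: unitary_mat_def)

lemma unitary_cscalar:
  assumes w: "unitary_mat n w" and x: "x \<in> carrier_vec n"
  shows "(w *\<^sub>v x) \<bullet>c (w *\<^sub>v x) = x \<bullet>c x"
proof -
  have c: "w \<in> carrier_mat n n" using w by (simp add: unitary_mat_def)
  have "(w *\<^sub>v x) \<bullet>c (w *\<^sub>v x) = x \<bullet>c (mat_adjoint w *\<^sub>v (w *\<^sub>v x))"
    using c x by (subst cscalar_adjoint[of _ n n]) auto
  also have "mat_adjoint w *\<^sub>v (w *\<^sub>v x) = (mat_adjoint w * w) *\<^sub>v x"
    using c x by (subst assoc_mult_mat_vec[of _ n n]) auto
  also have "\<dots> = x" using w x by (simp add: unitary_mat_def)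
  finally show ?thesis .
qed

text \<open>The block matrix with identities on the diagonal and \<open>w\<close> and its adjoint
  off the diagonal has as its quadratic form the squared norm of
  \<open>x 0 + w *\<^sub>v x 1\<close>, hence is positive; the claim evaluates its image at the pair
  \<open>y\<close>, \<open>z\<close>. In the complex order the inequality also says that the
  right-hand side is real.\<close>

lemma ucp_on_two_block:
  assumes d: "0 < d" and n: "0 < n" and SC: "S \<subseteq> carrier_mat d d"
    and S: "1\<^sub>m d \<in> S" "w \<in> S" "mat_adjoint w \<in> S"
    and w: "unitary_mat d w" and ucp: "ucp_on d n S \<psi>"
    and y: "y \<in> carrier_vec n" and z: "z \<in> carrier_vec n"
  shows "0 \<le> y \<bullet>c y + (\<psi> w *\<^sub>v z) \<bullet>c y + (\<psi> (mat_adjoint w) *\<^sub>v y) \<bullet>c z + z \<bullet>c z"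
proof -
  define X where "X i j = (if i = j then 1\<^sub>m d else if i = 0 then w else mat_adjoint w)" for i j :: nat
  have X: "X i j \<in> S" for i j using S by (simp add: X_def)
  have XC: "X i j \<in> carrier_mat d d" for i j using X SC by blast
  have wC: "w \<in> carrier_mat d d" using S SC by blast
  have "psd_mat (2 * d) (block_mat 2 d X)"
  proof (subst psd_block_mat_iff[OF d XC], intro allI impI)
    fix x :: "nat \<Rightarrow> complex vec" assume "\<forall>i<2. x i \<in> carrier_vec d"
    then have x: "x 0 \<in> carrier_vec d" "x 1 \<in> carrier_vec d" by auto
    have wx: "w *\<^sub>v x 1 \<in> carrier_vec d" using wC x by (intro mult_mat_vec_carrier)
    have "(mat_adjoint w *\<^sub>v x 0) \<bullet>c x 1 = x 0 \<bullet>c (w *\<^sub>v x 1)"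
      using x wC by (subst cscalar_adjoint[of _ d d]) auto
    \<comment> \<open>Unitarity replaces \<open>x 1 \<bullet>c x 1\<close> by
      \<open>(w *\<^sub>v x 1) \<bullet>c (w *\<^sub>v x 1)\<close>, which completes the
      square.\<close>
    then have "(\<Sum>i<2. \<Sum>l<2. (X i l *\<^sub>v x l) \<bullet>c x i) =
        x 0 \<bullet>c x 0 + (w *\<^sub>v x 1) \<bullet>c x 0 + x 0 \<bullet>c (w *\<^sub>v x 1) + (w *\<^sub>v x 1) \<bullet>c (w *\<^sub>v x 1)"
      using x unitary_cscalar[OF w x(2)] by (simp add: numeral_2_eq_2 X_def add.assoc)
    also have "\<dots> = (x 0 + w *\<^sub>v x 1) \<bullet>c (x 0 + w *\<^sub>v x 1)"
      using x wx by (simp add: conjugate_add_vec[of _ d] add_scalar_prod_distrib[of _ d]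
          scalar_prod_add_distrib[of _ d])
    finally show "0 \<le> (\<Sum>i<2. \<Sum>l<2. (X i l *\<^sub>v x l) \<bullet>c x i)"
      using conjugate_square_ge_0_vec by metis
  qed
  then have "psd_mat (2 * n) (block_mat 2 n (\<lambda>i j. \<psi> (X i j)))"
    using ucp X by (auto simp: ucp_on_iff completely_positive_on_def)
  moreover have "\<psi> (X i j) \<in> carrier_mat n n" for i j by (rule ucp_on_carrier[OF ucp X])
  ultimately have "\<forall>x. (\<forall>i<2. x i \<in> carrier_vec n) \<longrightarrow> 0 \<le> (\<Sum>i<2. \<Sum>l<2. (\<psi> (X i l) *\<^sub>v x l) \<bullet>c x i)"
    using psd_block_mat_iff[OF n, of 2 "\<lambda>i j. \<psi> (X i j)"] by blast
  from this[rule_format, of "\<lambda>i. if i = 0 then y else z"]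
  show ?thesis using y z ucp by (simp add: numeral_2_eq_2 X_def ucp_on_iff add.assoc)
qed

text \<open>The inequality of \<open>ucp_on_two_block\<close> serves in two ways: its reality, at
  \<open>y\<close> and at \<open>\<i> \<cdot>\<^sub>v y\<close>, identifies the image of the
  adjoint, and its sign at a suitable pair gives the contraction bound.\<close>

lemma ucp_on_unitary:
  assumes d: "0 < d" and n: "0 < n" and SC: "S \<subseteq> carrier_mat d d"
    and S: "1\<^sub>m d \<in> S" "w \<in> S" "mat_adjoint w \<in> S"
    and w: "unitary_mat d w" and ucp: "ucp_on d n S \<psi>"
  shows ucp_on_adjoint: "\<psi> (mat_adjoint w) = mat_adjoint (\<psi> w)"
    and ucp_on_contraction:
      "x \<in> carrier_vec n \<Longrightarrow> (\<psi> w *\<^sub>v x) \<bullet>c (\<psi> w *\<^sub>v x) \<le> x \<bullet>c x"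
proof -
  let ?A = "\<psi> w" and ?C = "\<psi> (mat_adjoint w)"
  have c: "?A \<in> carrier_mat n n" "?C \<in> carrier_mat n n" using ucp_on_carrier[OF ucp] S by blast+
  note pos = ucp_on_two_block[OF assms]
  have adj: "(?C *\<^sub>v y) \<bullet>c z = y \<bullet>c (?A *\<^sub>v z)" if y: "y \<in> carrier_vec n" and z: "z \<in> carrier_vec n" for y z
  proof -
    have Az: "?A *\<^sub>v z \<in> carrier_vec n" "?C *\<^sub>v y \<in> carrier_vec n" using c y z by auto
    \<comment> \<open>Nonnegative values are real, and so are \<open>y \<bullet>c y\<close> and
      \<open>z \<bullet>c z\<close>; hence the two cross terms have a real sum.\<close>
    have "Im ((?A *\<^sub>v z) \<bullet>c y + (?C *\<^sub>v y) \<bullet>c z) = 0"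
      using pos[OF y z] by (simp add: less_eq_complex_def)
    \<comment> \<open>Replacing \<open>y\<close> by \<open>\<i> \<cdot>\<^sub>v y\<close> multiplies
      the cross terms by \<open>- \<i>\<close> and \<open>\<i>\<close>. The resulting condition
      equates their real parts, while the previous one makes their imaginary parts opposite, so they
      are conjugate.\<close>
    moreover have iy: "\<i> \<cdot>\<^sub>v y \<in> carrier_vec n" using y by simp
    have "?C *\<^sub>v (\<i> \<cdot>\<^sub>v y) = \<i> \<cdot>\<^sub>v (?C *\<^sub>v y)" by (rule mult_mat_vec[OF c(2) y])
    then have "Im (- \<i> * ((?A *\<^sub>v z) \<bullet>c y) + \<i> * ((?C *\<^sub>v y) \<bullet>c z)) = 0"
      using pos[OF iy z] y z Az
      by (simp add: less_eq_complex_def cscalar_smult_right[of _ n] cscalar_smult_left[of _ n]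
          del: scalar_prod_smult_left scalar_prod_smult_right smult_scalar_prod_distrib scalar_prod_smult_distrib)
    ultimately have "(?C *\<^sub>v y) \<bullet>c z = cnj ((?A *\<^sub>v z) \<bullet>c y)"
      by (simp add: complex_eq_iff)
    then show ?thesis using cscalar_commute[OF y Az(1)] by simp
  qed
  show "?C = mat_adjoint ?A"
  proof (rule mat_eq_cscalarI)
    fix x y :: "complex vec" assume "x \<in> carrier_vec n" "y \<in> carrier_vec n"
    then show "(?C *\<^sub>v x) \<bullet>c y = (mat_adjoint ?A *\<^sub>v x) \<bullet>c y"
      using adj c by (subst cscalar_adjoint[of "mat_adjoint ?A" n n]) auto
  qed (use c in auto)
  show "(?A *\<^sub>v x) \<bullet>c (?A *\<^sub>v x) \<le> x \<bullet>c x" if x: "x \<in> carrier_vec n"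
  proof -
    \<comment> \<open>Choosing \<open>y\<close> as
      \<open>(-1) \<cdot>\<^sub>v (?A *\<^sub>v x)\<close> and \<open>z\<close> as \<open>x\<close>
      leaves \<open>x \<bullet>c x\<close> minus the squared norm of
      \<open>?A *\<^sub>v x\<close>.\<close>
    have Ax: "?A *\<^sub>v x \<in> carrier_vec n" "(-1) \<cdot>\<^sub>v (?A *\<^sub>v x) \<in> carrier_vec n" using c x by auto
    show ?thesis
      using pos[OF Ax(2) x] Ax x unfolding adj[OF Ax(2) x]
      by (simp add: cscalar_smult_right[of _ n] cscalar_smult_left[of _ n]
          del: scalar_prod_smult_left scalar_prod_smult_right smult_scalar_prod_distrib scalar_prod_smult_distrib)
  qed
qed

section \<open>Unitaries as matrix convex combinations of contractions\<close>

lemma cscalar_diff_self: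
  fixes x y :: "complex vec"
  assumes "x \<in> carrier_vec n" "y \<in> carrier_vec n"
  shows "(x - y) \<bullet>c (x - y) = x \<bullet>c x - x \<bullet>c y - y \<bullet>c x + y \<bullet>c y"
  using assms by (auto simp: scalar_prod_def algebra_simps sum.distrib sum_subtractf)

lemma vec_eq_if_diff_zero:
  fixes x y :: "'a :: ab_group_add vec"
  assumes "x \<in> carrier_vec n" "y \<in> carrier_vec n" "x - y = 0\<^sub>v n"
  shows "x = y"
proof (rule eq_vecI)
  fix i assume i: "i < dim_vec y"
  have "(x - y) $ i = 0" using i carrier_vecD[OF assms(2)] unfolding assms(3) by simp
  then show "x $ i = y $ i" using i by simp
qed (use carrier_vecD[OF assms(1)] carrier_vecD[OF assms(2)] in simp)

text \<open>The map V sending \<open>x\<close> to the family \<open>\<gamma> j *\<^sub>v x\<close>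
  is an isometry, and \<open>sum\<close> says that the block diagonal contraction formed by the
  \<open>A j\<close> compresses along V to \<open>w\<close>. Since \<open>w\<close> preserves norms,
  the compression loses no length, which forces the contraction to send V x to V (w x).\<close>

lemma compression_intertwines:
  assumes w: "unitary_mat n w" and co: "matrix_convex_coeffs n m N \<gamma>"
    and A: "\<And>j. j < m \<Longrightarrow> A j \<in> carrier_mat (N j) (N j)"
    and contr: "\<And>j x. j < m \<Longrightarrow> x \<in> carrier_vec (N j) \<Longrightarrow> (A j *\<^sub>v x) \<bullet>c (A j *\<^sub>v x) \<le> x \<bullet>c x"
    and sum: "finsum (cmat_space n) (\<lambda>j. mat_adjoint (\<gamma> j) * A j * \<gamma> j) {..<m} = w"
    and j: "j < m"
  shows "A j * \<gamma> j = \<gamma> j * w"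
proof -
  have wC: "w \<in> carrier_mat n n" using w by (simp add: unitary_mat_def)
  have \<gamma>: "\<gamma> j \<in> carrier_mat (N j) n" "mat_adjoint (\<gamma> j) \<in> carrier_mat n (N j)" if "j < m" for j
    using co that by (auto simp: matrix_convex_coeffs_def)
  have coeff_sum: "(\<Sum>j<m. (\<gamma> j *\<^sub>v x) \<bullet>c (\<gamma> j *\<^sub>v y)) = x \<bullet>c y"
    if x: "x \<in> carrier_vec n" and y: "y \<in> carrier_vec n" for x y
  proof -
    have "x \<bullet>c y = (finsum (cmat_space n) (\<lambda>j. mat_adjoint (\<gamma> j) * \<gamma> j) {..<m} *\<^sub>v x) \<bullet>c y"
      using co x by (simp add: matrix_convex_coeffs_def)
    also have "\<dots> = (\<Sum>j<m. (mat_adjoint (\<gamma> j) * \<gamma> j *\<^sub>v x) \<bullet>c y)"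
      using \<gamma> x y by (intro cscalar_finsum mult_carrier_mat) auto
    also have "\<dots> = (\<Sum>j<m. (\<gamma> j *\<^sub>v x) \<bullet>c (\<gamma> j *\<^sub>v y))"
    proof (intro sum.cong refl)
      fix j assume "j \<in> {..<m}"
      with \<gamma> have g: "\<gamma> j \<in> carrier_mat (N j) n" "mat_adjoint (\<gamma> j) \<in> carrier_mat n (N j)" by auto
      then show "(mat_adjoint (\<gamma> j) * \<gamma> j *\<^sub>v x) \<bullet>c y = (\<gamma> j *\<^sub>v x) \<bullet>c (\<gamma> j *\<^sub>v y)"
        using x y by (simp only: assoc_mult_mat_vec[OF g(2,1) x])
          (subst cscalar_adjoint[OF g(2)], auto)
    qed
    finally show ?thesis ..
  qed
  have w_sum: "(\<Sum>j<m. (A j *\<^sub>v (\<gamma> j *\<^sub>v x)) \<bullet>c (\<gamma> j *\<^sub>v y)) = (w *\<^sub>v x) \<bullet>c y"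
    if x: "x \<in> carrier_vec n" and y: "y \<in> carrier_vec n" for x y
  proof -
    have "(w *\<^sub>v x) \<bullet>c y = (\<Sum>j<m. (mat_adjoint (\<gamma> j) * A j * \<gamma> j *\<^sub>v x) \<bullet>c y)"
      unfolding sum[symmetric] using mult_carrier_mat[OF mult_carrier_mat[OF \<gamma>(2) A] \<gamma>(1)] x y
      by (intro cscalar_finsum) auto
    also have "\<dots> = (\<Sum>j<m. (A j *\<^sub>v (\<gamma> j *\<^sub>v x)) \<bullet>c (\<gamma> j *\<^sub>v y))"
    proof (intro sum.cong refl)
      fix j assume "j \<in> {..<m}"
      with \<gamma> A have g: "\<gamma> j \<in> carrier_mat (N j) n" "mat_adjoint (\<gamma> j) \<in> carrier_mat n (N j)"
        "A j \<in> carrier_mat (N j) (N j)" by auto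
      have "mat_adjoint (\<gamma> j) * A j * \<gamma> j *\<^sub>v x = mat_adjoint (\<gamma> j) *\<^sub>v (A j *\<^sub>v (\<gamma> j *\<^sub>v x))"
        using g x by (simp add: assoc_mult_mat_vec[of _ n "N j" _ n] assoc_mult_mat_vec[of _ n "N j" _ "N j"]
            del: assoc_mult_mat)
      then show "(mat_adjoint (\<gamma> j) * A j * \<gamma> j *\<^sub>v x) \<bullet>c y = (A j *\<^sub>v (\<gamma> j *\<^sub>v x)) \<bullet>c (\<gamma> j *\<^sub>v y)"
        using g x y by (simp only:) (subst cscalar_adjoint[OF g(2)], auto)
    qed
    finally show ?thesis ..
  qed
  have vec_eq: "A j *\<^sub>v (\<gamma> j *\<^sub>v x) = \<gamma> j *\<^sub>v (w *\<^sub>v x)" if x: "x \<in> carrier_vec n" for x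
  proof -
    \<comment> \<open>The defect of the claimed identity at \<open>x\<close> in component
      \<open>i\<close>; the sum of the squared norms of these defects turns out to be at most
      0.\<close>
    define e where "e i = A i *\<^sub>v (\<gamma> i *\<^sub>v x) - \<gamma> i *\<^sub>v (w *\<^sub>v x)" for i
    have wx: "w *\<^sub>v x \<in> carrier_vec n" using wC x by simp
    have c: "\<gamma> i *\<^sub>v x \<in> carrier_vec (N i)" "\<gamma> i *\<^sub>v (w *\<^sub>v x) \<in> carrier_vec (N i)"
      "A i *\<^sub>v (\<gamma> i *\<^sub>v x) \<in> carrier_vec (N i)" if "i < m" for i
      using \<gamma>(1)[OF that] A[OF that] x wx by auto
    have ww: "(w *\<^sub>v x) \<bullet>c (w *\<^sub>v x) = x \<bullet>c x" by (rule unitary_cscalar[OF w x])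
    \<comment> \<open>The cross terms in reverse order are the conjugates of those in
      \<open>w_sum\<close>, and their sum \<open>x \<bullet>c x\<close> is real.\<close>
    have w_sum': "(\<Sum>i<m. (\<gamma> i *\<^sub>v (w *\<^sub>v x)) \<bullet>c (A i *\<^sub>v (\<gamma> i *\<^sub>v x))) = x \<bullet>c x"
    proof -
      have "(\<Sum>i<m. (\<gamma> i *\<^sub>v (w *\<^sub>v x)) \<bullet>c (A i *\<^sub>v (\<gamma> i *\<^sub>v x)))
          = cnj (\<Sum>i<m. (A i *\<^sub>v (\<gamma> i *\<^sub>v x)) \<bullet>c (\<gamma> i *\<^sub>v (w *\<^sub>v x)))"
        unfolding cnj_sum using c by (intro sum.cong refl cscalar_commute) auto
      then show ?thesis using w_sum[OF x wx] ww cscalar_commute[OF x x] by simp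
    qed
    have "(\<Sum>i<m. e i \<bullet>c e i) = (\<Sum>i<m. (A i *\<^sub>v (\<gamma> i *\<^sub>v x)) \<bullet>c (A i *\<^sub>v (\<gamma> i *\<^sub>v x))
        - (A i *\<^sub>v (\<gamma> i *\<^sub>v x)) \<bullet>c (\<gamma> i *\<^sub>v (w *\<^sub>v x)) - (\<gamma> i *\<^sub>v (w *\<^sub>v x)) \<bullet>c (A i *\<^sub>v (\<gamma> i *\<^sub>v x))
        + (\<gamma> i *\<^sub>v (w *\<^sub>v x)) \<bullet>c (\<gamma> i *\<^sub>v (w *\<^sub>v x)))"
      unfolding e_def using c by (intro sum.cong refl cscalar_diff_self) auto
    \<comment> \<open>Both cross sums and the last sum equal \<open>x \<bullet>c x\<close>, with
      signs minus, minus and plus.\<close>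
    also have "\<dots> = (\<Sum>i<m. (A i *\<^sub>v (\<gamma> i *\<^sub>v x)) \<bullet>c (A i *\<^sub>v (\<gamma> i *\<^sub>v x))) - x \<bullet>c x"
      by (simp add: sum.distrib sum_subtractf w_sum[OF x wx] w_sum' coeff_sum[OF wx wx] ww)
    also have "\<dots> \<le> (\<Sum>i<m. (\<gamma> i *\<^sub>v x) \<bullet>c (\<gamma> i *\<^sub>v x)) - x \<bullet>c x"
      using c contr by (intro diff_right_mono sum_mono) auto
    also have "\<dots> = 0" using coeff_sum[OF x x] by simp
    finally have "(\<Sum>i<m. e i \<bullet>c e i) = 0"
      using sum_nonneg[of "{..<m}" "\<lambda>i. e i \<bullet>c e i"] conjugate_square_ge_0_vec by (auto intro: antisym)
    then have "e j \<bullet>c e j = 0"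
      using j conjugate_square_ge_0_vec by (subst (asm) sum_nonneg_eq_0_iff) auto
    moreover have "e j \<in> carrier_vec (N j)" using c[OF j] by (simp add: e_def)
    ultimately have "e j = 0\<^sub>v (N j)" using conjugate_square_eq_0_vec by blast
    then show ?thesis unfolding e_def by (rule vec_eq_if_diff_zero[OF c(3,2)[OF j]])
  qed
  show ?thesis
  proof (rule mat_eq_cscalarI)
    fix x y :: "complex vec" assume "x \<in> carrier_vec n" "y \<in> carrier_vec (N j)"
    then show "(A j * \<gamma> j *\<^sub>v x) \<bullet>c y = (\<gamma> j * w *\<^sub>v x) \<bullet>c y"
      using vec_eq A[OF j] \<gamma>[OF j] wC by (simp add: assoc_mult_mat_vec[of _ _ "N j" _ n] assoc_mult_mat_vec[of _ _ n _ n])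
  qed (use A[OF j] \<gamma>[OF j] wC in auto)
qed


section \<open>Irreducible tuples of unitaries\<close>

lemma mat_adjoint_finsum:
  assumes "finite I" and f: "\<And>j. j \<in> I \<Longrightarrow> f j \<in> carrier_mat n n"
  shows "mat_adjoint (finsum (cmat_space n) f I) = finsum (cmat_space n) (\<lambda>j. mat_adjoint (f j)) I"
proof -
  have c: "finsum (cmat_space n) f I \<in> carrier_mat n n"
    "finsum (cmat_space n) (\<lambda>j. mat_adjoint (f j)) I \<in> carrier_mat n n"
    using f by (auto intro!: finsum_cmat_closed)
  show ?thesis
  proof (rule eq_matI)
    fix r s assume "r < dim_row (finsum (cmat_space n) (\<lambda>j. mat_adjoint (f j)) I)"
      "s < dim_col (finsum (cmat_space n) (\<lambda>j. mat_adjoint (f j)) I)"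
    then have rs: "r < n" "s < n" using c by auto
    have "mat_adjoint (finsum (cmat_space n) f I) $$ (r, s) = (\<Sum>j\<in>I. cnj (f j $$ (s, r)))"
      using rs c assms by (simp add: index_finsum_cmat_space)
    also have "\<dots> = (\<Sum>j\<in>I. mat_adjoint (f j) $$ (r, s))"
    proof (rule sum.cong[OF refl])
      fix j assume "j \<in> I"
      from f[OF this] show "cnj (f j $$ (s, r)) = mat_adjoint (f j) $$ (r, s)" using rs by auto
    qed
    also have "\<dots> = finsum (cmat_space n) (\<lambda>j. mat_adjoint (f j)) I $$ (r, s)"
      using rs assms by (intro index_finsum_cmat_space[symmetric]) auto
    finally show "mat_adjoint (finsum (cmat_space n) f I) $$ (r, s) =
      finsum (cmat_space n) (\<lambda>j. mat_adjoint (f j)) I $$ (r, s)" .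
  qed (use c in auto)
qed

text \<open>By \<open>gram\<close>, \<gamma> multiplies squared norms by \<open>c\<close>, so
  \<open>c\<close> is nonnegative. Surjectivity onto a space of positive dimension excludes 0 and
  also yields the opposite Gram identity, so dividing \<gamma> by the square root of
  \<open>c\<close> gives a unitary.\<close>

lemma scalar_gram_surjective:
  assumes N: "0 < N" and n: "0 < n" and \<gamma>: "\<gamma> \<in> carrier_mat N n"
    and surj: "surjective_mat N n \<gamma>"
    and gram: "mat_adjoint \<gamma> * \<gamma> = c \<cdot>\<^sub>m 1\<^sub>m n"
  obtains r where "N = n" "0 < r" "c = complex_of_real r"
    "unitary_mat n (complex_of_real (1 / sqrt r) \<cdot>\<^sub>m \<gamma>)"
proof -
  have \<gamma>a: "mat_adjoint \<gamma> \<in> carrier_mat n N" using \<gamma> by simp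
  have sq: "(\<gamma> *\<^sub>v x) \<bullet>c (\<gamma> *\<^sub>v x) = c * (x \<bullet>c x)" if x: "x \<in> carrier_vec n" for x
  proof -
    have "(\<gamma> *\<^sub>v x) \<bullet>c (\<gamma> *\<^sub>v x) = (mat_adjoint \<gamma> *\<^sub>v (\<gamma> *\<^sub>v x)) \<bullet>c x"
      using \<gamma> x by (subst cscalar_adjoint[OF \<gamma>a]) auto
    also have "\<dots> = ((c \<cdot>\<^sub>m 1\<^sub>m n) *\<^sub>v x) \<bullet>c x"
      using assoc_mult_mat_vec[OF \<gamma>a \<gamma> x] gram by simp
    also have "(c \<cdot>\<^sub>m 1\<^sub>m n) *\<^sub>v x = c \<cdot>\<^sub>v x" using x by (intro eq_vecI) auto
    finally show ?thesis using x by simp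
  qed
  have "c = (\<gamma> *\<^sub>v unit_vec n 0) \<bullet>c (\<gamma> *\<^sub>v unit_vec n 0)"
  proof -
    have "unit_vec n 0 \<bullet>c unit_vec n 0 = (1 :: complex)"
      using n by (simp add: scalar_prod_def unit_vec_def if_distrib[of cnj] if_distrib[of "(*) a" for a] cong: if_cong)
    then show ?thesis using sq[of "unit_vec n 0"] by simp
  qed
  then have "0 \<le> c" using conjugate_square_ge_0_vec by metis
  then obtain r where c: "c = complex_of_real r" and r0: "0 \<le> r"
    using that[of "Re c"] by (auto simp: less_eq_complex_def complex_eq_iff)
  have "r \<noteq> 0"
  proof
    assume "r = 0"
    then have "\<gamma> *\<^sub>v x = 0\<^sub>v N" if "x \<in> carrier_vec n" for x
      using sq[OF that] c conjugate_square_eq_0_vec[of "\<gamma> *\<^sub>v x" N] \<gamma> that by simp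
    moreover have "unit_vec N 0 \<in> (\<lambda>x. \<gamma> *\<^sub>v x) ` carrier_vec n"
      using surj unfolding surjective_mat_def by simp
    ultimately have "unit_vec N 0 = (0\<^sub>v N :: complex vec)" by auto
    then have "unit_vec N 0 $ 0 = (0\<^sub>v N :: complex vec) $ 0" by (rule arg_cong)
    then show False using N by simp
  qed
  with r0 have r: "0 < r" by simp
  \<comment> \<open>By surjectivity each \<open>y\<close> is \<open>\<gamma> *\<^sub>v x\<close>,
    and applying \<gamma> to \<open>(mat_adjoint \<gamma> * \<gamma>) *\<^sub>v x = c
    \<cdot>\<^sub>v x\<close> gives \<open>c \<cdot>\<^sub>v y\<close>.\<close>
  have cogram: "\<gamma> * mat_adjoint \<gamma> = c \<cdot>\<^sub>m 1\<^sub>m N"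
  proof (rule mat_eq_cscalarI)
    fix y w :: "complex vec" assume y: "y \<in> carrier_vec N"
    then obtain x where x: "x \<in> carrier_vec n" "y = \<gamma> *\<^sub>v x" using surj unfolding surjective_mat_def by blast
    have "\<gamma> * mat_adjoint \<gamma> *\<^sub>v y = \<gamma> *\<^sub>v ((mat_adjoint \<gamma> * \<gamma>) *\<^sub>v x)"
      using x \<gamma> y assoc_mult_mat_vec[OF \<gamma> \<gamma>a y] assoc_mult_mat_vec[OF \<gamma>a \<gamma> x(1)] by simp
    also have "(mat_adjoint \<gamma> * \<gamma>) *\<^sub>v x = c \<cdot>\<^sub>v x" unfolding gram using x by (intro eq_vecI) auto
    also have "\<gamma> *\<^sub>v (c \<cdot>\<^sub>v x) = c \<cdot>\<^sub>v y" using mult_mat_vec[OF \<gamma> x(1)] x(2) by simp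
    also have "\<dots> = (c \<cdot>\<^sub>m 1\<^sub>m N) *\<^sub>v y" using y by (intro eq_vecI) auto
    finally show "(\<gamma> * mat_adjoint \<gamma> *\<^sub>v y) \<bullet>c w = ((c \<cdot>\<^sub>m 1\<^sub>m N) *\<^sub>v y) \<bullet>c w" by simp
  qed (use \<gamma> in auto)
  \<comment> \<open>\<open>N = n\<close> by comparing the traces of \<open>\<gamma>\<^sup>*\<gamma> = c 1\<^sub>n\<close> and \<open>\<gamma>\<gamma>\<^sup>* = c 1\<^sub>N\<close>.\<close>
  have "of_nat N * c = (\<Sum>i<N. (\<gamma> * mat_adjoint \<gamma>) $$ (i, i))" by (simp add: cogram)
  also have "\<dots> = (\<Sum>i<N. \<Sum>j<n. \<gamma> $$ (i, j) * cnj (\<gamma> $$ (i, j)))"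
    using \<gamma> by (auto simp: scalar_prod_def lessThan_atLeast0 intro!: sum.cong)
  also have "\<dots> = (\<Sum>j<n. \<Sum>i<N. \<gamma> $$ (i, j) * cnj (\<gamma> $$ (i, j)))" by (rule sum.swap)
  also have "\<dots> = (\<Sum>j<n. (mat_adjoint \<gamma> * \<gamma>) $$ (j, j))"
    using \<gamma> by (auto simp: scalar_prod_def lessThan_atLeast0 mult.commute intro!: sum.cong)
  also have "\<dots> = of_nat n * c" by (simp add: gram)
  finally have Nn: "N = n" using r c by simp
  define s where "s = complex_of_real (1 / sqrt r)"
  have ss: "s * s * c = 1" "cnj s = s" "s * (s * c) = 1"
    using r by (simp_all add: s_def c flip: of_real_mult)
  have "mat_adjoint (s \<cdot>\<^sub>m \<gamma>) * (s \<cdot>\<^sub>m \<gamma>) = (s * s * c) \<cdot>\<^sub>m 1\<^sub>m n"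
    using \<gamma> \<gamma>a gram by (auto simp: mat_adjoint_smult ss(2) mult_smult_distrib[of _ n N] mult_smult_assoc_mat[of _ n N] mult.assoc)
  moreover have "(s \<cdot>\<^sub>m \<gamma>) * mat_adjoint (s \<cdot>\<^sub>m \<gamma>) = (s * s * c) \<cdot>\<^sub>m 1\<^sub>m N"
    using \<gamma> \<gamma>a cogram by (auto simp: mat_adjoint_smult ss(2) mult_smult_distrib[of _ N n] mult_smult_assoc_mat[of _ N n] mult.assoc)
  moreover have one_mat: "(1 :: complex) \<cdot>\<^sub>m 1\<^sub>m n = 1\<^sub>m n" by (rule eq_matI) auto
  ultimately have "unitary_mat n (s \<cdot>\<^sub>m \<gamma>)"
    unfolding unitary_mat_def ss(1) using \<gamma> Nn one_mat by simp
  then show ?thesis using that Nn r c unfolding s_def by blast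
qed

text \<open>Each coefficient of a matrix convex combination equal to \<open>z\<close> intertwines
  the point it compresses with \<open>z\<close>, so its Gram matrix lies in the commutant of
  \<open>z\<close>. In \<open>irr\<close> the matrix \<open>M\<close> commutes with the
  \<open>w\<close> themselves; their adjoints are their inverses, so \<open>M\<close> commutes with
  these too and the hypothesis is irreducibility.\<close>

lemma irreducible_unitary_tuple_matrix_extreme:
  assumes n: "0 < n" and uz: "\<And>w. w \<in> set z \<Longrightarrow> unitary_mat n w"
    and irr: "\<And>M. M \<in> carrier_mat n n \<Longrightarrow> (\<And>w. w \<in> set z \<Longrightarrow> M * w = w * M) \<Longrightarrow> \<exists>c. M = c \<cdot>\<^sub>m 1\<^sub>m n"
  shows "matrix_extreme_point (length z) (matrix_range n z) n z"
proof -
  interpret M: Module.module class_ring "cmat_space n" by (rule module_cmat_space)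
  have z: "set z \<subseteq> carrier_mat n n" using uz by (auto simp: unitary_mat_def)
  note S = op_span_carrier[OF z] one_in_op_span[OF z]
  have main: "N j = n \<and> unitarily_equiv n (a j) z"
    if co: "matrix_convex_coeffs n m N \<gamma>" and a: "\<forall>j<m. a j \<in> matrix_range n z (N j)"
      and surj: "\<forall>j<m. surjective_mat (N j) n (\<gamma> j)"
      and comb: "z = matrix_convex_comb (length z) n m \<gamma> a" and j: "j < m"
    for m N \<gamma> a j
  proof -
    have N: "0 < N i" "\<gamma> i \<in> carrier_mat (N i) n" "mat_adjoint (\<gamma> i) \<in> carrier_mat n (N i)" if "i < m" for i
      using co that by (auto simp: matrix_convex_coeffs_def)
    have "\<forall>i\<in>{..<m}. \<exists>\<psi>. a i = map \<psi> z \<and> ucp_on n (N i) (op_span n z) \<psi>"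
      using a by (auto simp: matrix_range_def)
    then obtain \<psi> where \<psi>: "\<And>i. i < m \<Longrightarrow> a i = map (\<psi> i) z"
        "\<And>i. i < m \<Longrightarrow> ucp_on n (N i) (op_span n z) (\<psi> i)"
      unfolding bchoice_iff by auto
    have intertwine: "\<psi> j w * \<gamma> j = \<gamma> j * w \<and> mat_adjoint (\<psi> j w) * \<gamma> j = \<gamma> j * mat_adjoint w"
      if w: "w \<in> set z" for w
    proof
      note Sw = in_op_span[OF z w] adjoint_in_op_span[OF z w]
      have Sw': "mat_adjoint (mat_adjoint w) \<in> op_span n z" using Sw by simp
      note uw = uz[OF w] unitary_mat_adjoint[OF uz[OF w]]
      have A: "\<psi> i w \<in> carrier_mat (N i) (N i)" if "i < m" for i
        using ucp_on_carrier[OF \<psi>(2)[OF that]] Sw by blast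
      \<comment> \<open>The adjoint passes through each \<open>\<psi> i\<close>, so the second
        intertwining relation becomes the first one for the unitary
        \<open>mat_adjoint w\<close>.\<close>
      note adj = ucp_on_adjoint[OF n N(1) S Sw uw(1) \<psi>(2)]
      have T: "mat_adjoint (\<gamma> i) * \<psi> i w * \<gamma> i \<in> carrier_mat n n" if "i < m" for i
        using N[OF that] A[OF that] by (intro mult_carrier_mat) auto
      obtain k where k: "k < length z" "w = z ! k" using w by (auto simp: in_set_conv_nth)
      have "w = matrix_convex_comb (length z) n m \<gamma> a ! k" unfolding k(2) by (rule arg_cong[OF comb])
      also have "\<dots> = finsum (cmat_space n) (\<lambda>i. compress (\<gamma> i) (a i) ! k) {..<m}"
        using k by (simp add: matrix_convex_comb_def)
      also have "\<dots> = finsum (cmat_space n) (\<lambda>i. mat_adjoint (\<gamma> i) * \<psi> i w * \<gamma> i) {..<m}"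
        using T k \<psi>(1) by (intro M.finsum_cong') (auto simp: compress_def cmat_space_simps simp del: carrier_matI)
      finally have sum: "finsum (cmat_space n) (\<lambda>i. mat_adjoint (\<gamma> i) * \<psi> i w * \<gamma> i) {..<m} = w" ..
      show "\<psi> j w * \<gamma> j = \<gamma> j * w"
        using ucp_on_contraction[OF n N(1) S Sw uw(1) \<psi>(2)] A j sum
        by (intro compression_intertwines[OF uw(1) co]) auto
      \<comment> \<open>Taking adjoints termwise in \<open>sum\<close> writes
        \<open>mat_adjoint w\<close> as the combination of the matrices
        \<open>mat_adjoint (\<psi> i w)\<close> with the same coefficients.\<close>
      have "finsum (cmat_space n) (\<lambda>i. mat_adjoint (\<gamma> i) * mat_adjoint (\<psi> i w) * \<gamma> i) {..<m}
          = finsum (cmat_space n) (\<lambda>i. mat_adjoint (mat_adjoint (\<gamma> i) * \<psi> i w * \<gamma> i)) {..<m}"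
      proof (rule M.finsum_cong')
        fix i assume "i \<in> {..<m}"
        then have i: "i < m" by simp
        show "mat_adjoint (\<gamma> i) * mat_adjoint (\<psi> i w) * \<gamma> i = mat_adjoint (mat_adjoint (\<gamma> i) * \<psi> i w * \<gamma> i)"
          using N[OF i] A[OF i]
          by (simp add: mat_adjoint_mult[of _ n "N i" _ n] mat_adjoint_mult[of _ "N i" "N i" _ n] assoc_mult_mat[of _ n "N i" _ "N i"])
      qed (use T in \<open>auto simp: cmat_space_simps\<close>)
      also have "\<dots> = mat_adjoint w"
        using T by (subst mat_adjoint_finsum[symmetric]) (auto simp: sum)
      finally have sum': "finsum (cmat_space n) (\<lambda>i. mat_adjoint (\<gamma> i) * mat_adjoint (\<psi> i w) * \<gamma> i) {..<m} = mat_adjoint w" .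
      show "mat_adjoint (\<psi> j w) * \<gamma> j = \<gamma> j * mat_adjoint w"
        using ucp_on_contraction[OF n N(1) S(1,2) Sw(2) Sw' uw(2) \<psi>(2)] A j sum' adj
        by (intro compression_intertwines[OF uw(2) co]) auto
    qed
    define G where "G = mat_adjoint (\<gamma> j) * \<gamma> j"
    \<comment> \<open>The first relation moves \<open>w\<close> across \<open>\<gamma> j\<close>,
      and the adjoint of the second moves it across \<open>mat_adjoint (\<gamma> j)\<close>.\<close>
    have "G * w = w * G" if w: "w \<in> set z" for w
    proof -
      have c: "\<psi> j w \<in> carrier_mat (N j) (N j)" "w \<in> carrier_mat n n" "mat_adjoint (\<psi> j w) \<in> carrier_mat (N j) (N j)"
        "mat_adjoint w \<in> carrier_mat n n"
        using ucp_on_carrier[OF \<psi>(2)[OF j] in_op_span[OF z w]] z w by auto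
      have "G * w = mat_adjoint (\<gamma> j) * (\<psi> j w * \<gamma> j)"
        using intertwine[OF w] c N[OF j] by (simp add: G_def assoc_mult_mat[of _ n "N j" _ n])
      also have "\<dots> = mat_adjoint (mat_adjoint (\<psi> j w) * \<gamma> j) * \<gamma> j"
        using c N[OF j] by (simp add: mat_adjoint_mult[OF c(3) N(2)[OF j]] assoc_mult_mat[of _ n "N j" _ "N j"])
      also have "\<dots> = w * mat_adjoint (\<gamma> j) * \<gamma> j"
        using intertwine[OF w] mat_adjoint_mult[OF N(2)[OF j] c(4)] by simp
      also have "\<dots> = w * G" using c N[OF j] by (simp add: G_def assoc_mult_mat[of _ n n _ "N j"])
      finally show ?thesis .
    qed
    moreover have "G \<in> carrier_mat n n" unfolding G_def using N[OF j] by (intro mult_carrier_mat)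
    ultimately obtain c where c: "mat_adjoint (\<gamma> j) * \<gamma> j = c \<cdot>\<^sub>m 1\<^sub>m n"
      using irr unfolding G_def by blast
    from scalar_gram_surjective[OF N(1)[OF j] n N(2)[OF j] surj[rule_format, OF j] c]
    obtain r where r: "N j = n" "0 < r" "c = complex_of_real r"
      "unitary_mat n (complex_of_real (1 / sqrt r) \<cdot>\<^sub>m \<gamma> j)" .
    let ?s = "complex_of_real (1 / sqrt r)"
    \<comment> \<open>The scaling makes \<open>U\<close> unitary and preserves the linear relation
      \<open>\<psi> j w * U = U * w\<close>; multiplying by \<open>mat_adjoint U\<close> on the left
      then gives the unitary equivalence.\<close>
    define U where "U = ?s \<cdot>\<^sub>m \<gamma> j"
    have "mat_adjoint U * \<psi> j w * U = w" if w: "w \<in> set z" for w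
    proof -
      have cr: "\<psi> j w \<in> carrier_mat n n" "w \<in> carrier_mat n n" "\<gamma> j \<in> carrier_mat n n"
        "mat_adjoint U \<in> carrier_mat n n" "U \<in> carrier_mat n n"
        using ucp_on_carrier[OF \<psi>(2)[OF j] in_op_span[OF z w]] z w N[OF j] r(1) by (auto simp: U_def)
      have "\<psi> j w * U = ?s \<cdot>\<^sub>m (\<psi> j w * \<gamma> j)"
        unfolding U_def by (rule mult_smult_distrib[OF cr(1,3)])
      also have "\<dots> = ?s \<cdot>\<^sub>m (\<gamma> j * w)" using intertwine[OF w] by simp
      also have "\<dots> = U * w" unfolding U_def by (rule mult_smult_assoc_mat[OF cr(3,2), symmetric])
      finally have "mat_adjoint U * \<psi> j w * U = mat_adjoint U * (U * w)"
        by (simp only: assoc_mult_mat[OF cr(4,1,5)])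
      also have "\<dots> = w"
        using r(4) cr(2) unfolding assoc_mult_mat[OF cr(4,5,2), symmetric]
        by (simp add: unitary_mat_def U_def)
      finally show ?thesis .
    qed
    then have "compress U (a j) = z"
      unfolding compress_def \<psi>(1)[OF j] map_map by (intro map_idI) simp
    then show ?thesis using r(1,4) unfolding unitarily_equiv_def U_def by blast
  qed
  show ?thesis unfolding matrix_extreme_point_def
    using matrix_convex_matrix_range[OF z] n generators_in_matrix_range[OF z] main by blast
qed

section \<open>Unitarity and irreducibility of the Weyl pair\<close>

lemma norm_primitive_root_unity: "primitive_root_unity p \<zeta> \<Longrightarrow> norm \<zeta> = 1"
  unfolding primitive_root_unity_def using power_eq_1_iff[of \<zeta> p] by blast

text \<open>Equal powers with exponents \<open>i < j < p\<close> would cancel to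
  \<open>\<zeta> ^ (j - i) = 1\<close> with \<open>0 < j - i < p\<close>, against
  primitivity.\<close>

lemma inj_on_primitive_root_powers:
  assumes "primitive_root_unity p \<zeta>"
  shows "inj_on (\<lambda>i. \<zeta> ^ i) {..<p}"
proof (rule linorder_inj_onI)
  fix i j :: nat assume ij: "i < j" "i \<in> {..<p}" "j \<in> {..<p}"
  have "\<zeta> \<noteq> 0" using norm_primitive_root_unity[OF assms] by auto
  moreover have "\<zeta> ^ (j - i) \<noteq> 1" using assms ij by (auto simp: primitive_root_unity_def)
  moreover have "\<zeta> ^ j = \<zeta> ^ i * \<zeta> ^ (j - i)" using ij by (simp flip: power_add)
  ultimately show "\<zeta> ^ i \<noteq> \<zeta> ^ j" by simp
qed auto

text \<open>A left inverse of a square matrix is also a right inverse.\<close>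

lemma unitary_matI:
  assumes A: "A \<in> carrier_mat n n" and "mat_adjoint A * A = 1\<^sub>m n"
  shows "unitary_mat n A"
  using mat_mult_left_right_inverse[of "mat_adjoint A" n A] assms by (simp add: unitary_mat_def)

lemma unitary_weyl_u:
  assumes "primitive_root_unity p \<zeta>"
  shows "unitary_mat p (weyl_u p \<zeta>)"
proof (rule unitary_matI)
  \<comment> \<open>On the unit circle the conjugate is the inverse.\<close>
  have z: "cnj \<zeta> ^ i * \<zeta> ^ i = 1" for i
    using norm_primitive_root_unity[OF assms]
    by (simp flip: power_mult_distrib add: mult.commute complex_norm_square[symmetric])
  show "mat_adjoint (weyl_u p \<zeta>) * weyl_u p \<zeta> = 1\<^sub>m p"
    by (rule eq_matI) (auto simp: weyl_u_def scalar_prod_def if_distrib[of cnj] if_distrib[of "(*) a" for a]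
        if_distrib[of "\<lambda>f. f b" for b] z cong: if_cong)
qed (simp add: weyl_u_def)

lemma unitary_weyl_v: "unitary_mat p (weyl_v p)"
proof (rule unitary_matI)
  \<comment> \<open>The cyclic permutation sending a column to the row of its single entry 1, with
    the last column going to row 0; its injectivity on the indices makes the columns
    orthonormal.\<close>
  define \<sigma> where "\<sigma> j = (if j = p - 1 then 0 else Suc j)" for j
  have v: "weyl_v p $$ (i, j) = (if i = \<sigma> j then 1 else 0)" if "i < p" "j < p" for i j
    using that by (auto simp: weyl_v_def \<sigma>_def)
  have \<sigma>: "\<sigma> i < p" "\<sigma> i = \<sigma> j \<longleftrightarrow> i = j" if "i < p" "j < p" for i j
    using that by (auto simp: \<sigma>_def)
  show "mat_adjoint (weyl_v p) * weyl_v p = 1\<^sub>m p"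
  proof (rule eq_matI)
    fix i j assume "i < dim_row (1\<^sub>m p)" "j < dim_col (1\<^sub>m p)"
    then have ij: "i < p" "j < p" by auto
    have "(mat_adjoint (weyl_v p) * weyl_v p) $$ (i, j) = (\<Sum>k<p. cnj (weyl_v p $$ (k, i)) * weyl_v p $$ (k, j))"
      using ij by (auto simp: scalar_prod_def weyl_v_def lessThan_atLeast0 intro!: sum.cong)
    also have "\<dots> = (\<Sum>k<p. if k = \<sigma> i then (if i = j then 1 else 0) else 0)"
      using ij \<sigma> by (intro sum.cong refl) (auto simp: v)
    finally show "(mat_adjoint (weyl_v p) * weyl_v p) $$ (i, j) = 1\<^sub>m p $$ (i, j)"
      using ij \<sigma>(1)[OF ij] by simp
  qed (auto simp: weyl_v_def)
qed (simp add: weyl_v_def)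

text \<open>Both relations are compared entrywise. Off the diagonal the first gives
  \<open>M $$ (i, j) * \<zeta> ^ j = M $$ (i, j) * \<zeta> ^ i\<close> with distinct powers of
  \<zeta>; the second links consecutive diagonal entries.\<close>

lemma weyl_pair_irreducible:
  assumes \<zeta>: "primitive_root_unity p \<zeta>" and M: "M \<in> carrier_mat p p"
    and u: "M * weyl_u p \<zeta> = weyl_u p \<zeta> * M" and v: "M * weyl_v p = weyl_v p * M"
  shows "\<exists>c. M = c \<cdot>\<^sub>m 1\<^sub>m p"
proof -
  have prod: "(A * B) $$ (i, j) = (\<Sum>k<p. A $$ (i, k) * B $$ (k, j))"
    if "A \<in> carrier_mat p p" "B \<in> carrier_mat p p" "i < p" "j < p" for A B :: "complex mat" and i j
    using that by (auto simp: scalar_prod_def lessThan_atLeast0 intro!: sum.cong)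
  have W: "weyl_u p \<zeta> \<in> carrier_mat p p" "weyl_v p \<in> carrier_mat p p"
    by (simp_all add: weyl_u_def weyl_v_def)
  have off: "M $$ (i, j) = 0" if ij: "i < p" "j < p" "i \<noteq> j" for i j
  proof -
    have "(M * weyl_u p \<zeta>) $$ (i, j) = (\<Sum>k<p. if k = j then M $$ (i, j) * \<zeta> ^ j else 0)"
      unfolding prod[OF M W(1) ij(1,2)] using ij
      by (intro sum.cong refl) (auto simp: weyl_u_def)
    also have "\<dots> = M $$ (i, j) * \<zeta> ^ j" using ij by simp
    finally have Mu: "(M * weyl_u p \<zeta>) $$ (i, j) = M $$ (i, j) * \<zeta> ^ j" .
    have "(weyl_u p \<zeta> * M) $$ (i, j) = (\<Sum>k<p. if k = i then M $$ (i, j) * \<zeta> ^ i else 0)"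
      unfolding prod[OF W(1) M ij(1,2)] using ij
      by (intro sum.cong refl) (auto simp: weyl_u_def)
    also have "\<dots> = M $$ (i, j) * \<zeta> ^ i" using ij by simp
    finally have "M $$ (i, j) * \<zeta> ^ j = M $$ (i, j) * \<zeta> ^ i"
      unfolding u[symmetric] Mu .
    moreover have "\<zeta> ^ j \<noteq> \<zeta> ^ i"
      using inj_onD[OF inj_on_primitive_root_powers[OF \<zeta>], of j i] ij by auto
    ultimately show ?thesis by (simp only: mult_cancel_left) simp
  qed
  \<comment> \<open>In the entry \<open>(Suc j, j)\<close> each product has a single surviving term,
    from the subdiagonal ones of \<open>weyl_v p\<close>. The bound \<open>Suc j < p\<close> keeps
    column \<open>j\<close> away from the corner entry.\<close>
  have step: "M $$ (Suc j, Suc j) = M $$ (j, j)" if j: "Suc j < p" for j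
  proof -
    have "(M * weyl_v p) $$ (Suc j, j) = (\<Sum>k<p. if k = Suc j then M $$ (Suc j, Suc j) else 0)"
      unfolding prod[OF M W(2) j Suc_lessD[OF j]] using j
      by (intro sum.cong refl) (auto simp: weyl_v_def)
    also have "\<dots> = M $$ (Suc j, Suc j)" using j by simp
    finally have Mv: "(M * weyl_v p) $$ (Suc j, j) = M $$ (Suc j, Suc j)" .
    have "(weyl_v p * M) $$ (Suc j, j) = (\<Sum>k<p. if k = j then M $$ (j, j) else 0)"
      unfolding prod[OF W(2) M j Suc_lessD[OF j]] using j
      by (intro sum.cong refl) (auto simp: weyl_v_def)
    also have "\<dots> = M $$ (j, j)" using j by simp
    finally show ?thesis unfolding v[symmetric] Mv .
  qed
  define c where "c = M $$ (0, 0)"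
  have diag: "M $$ (i, i) = c" if "i < p" for i
    using that by (induction i) (simp_all add: step c_def)
  have "M = c \<cdot>\<^sub>m 1\<^sub>m p"
  proof (rule eq_matI)
    fix i j assume "i < dim_row (c \<cdot>\<^sub>m 1\<^sub>m p)" "j < dim_col (c \<cdot>\<^sub>m 1\<^sub>m p)"
    then show "M $$ (i, j) = (c \<cdot>\<^sub>m 1\<^sub>m p) $$ (i, j)" by (simp add: diag off)
  qed (use M in simp_all)
  then show ?thesis by blast
qed

theorem theorem5p3:
  fixes p :: nat and \<zeta> :: complex
  assumes "2 \<le> p"
    and "primitive_root_unity p \<zeta>"
  shows "matrix_extreme_point 2 (matrix_range p [weyl_u p \<zeta>, weyl_v p]) p [weyl_u p \<zeta>, weyl_v p]"
  using irreducible_unitary_tuple_matrix_extreme[of p "[weyl_u p \<zeta>, weyl_v p]"]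
    unitary_weyl_u[OF assms(2)] unitary_weyl_v[of p] weyl_pair_irreducible[OF assms(2)] assms(1)
  by (auto simp: numeral_2_eq_2)

end
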